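(* If there is an algorithm that enumerates all inclusion-minimal connected dominating sets of split graphs with polynomial delay, then there is an algorithm that enumerates all inclusion-minimal hitting sets of hypergraphs with polynomial delay.
   Context: A connected dominating set of a graph $G=(V,E)$ is a set $S\subseteq V$ such that every vertex outside $S$ has a neighbor in $S$ and $G[S]$ is connected; it is minimal if no proper subset is one. A split graph is a graph whose vertex set can be partitioned into a clique and an independent set. A hypergraph is a pair $(X,\mathcal{S})$ with $\mathcal{S}\subseteq 2^X$; a hitting set is a set $H\subseteq X$ with $H\cap S\neq\emptyset$ for all $S\in\mathcal{S}$, minimal if no proper subset is a hitting set. An enumeration algorithm has polynomial delay if the time before the first output, between consecutive outputs, and after the last output until termination is bounded by a polynomial in the input size, and every solution is output exactly once. *)

theory Defs
  imports Main
begin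

definition is_graph :: "nat \<Rightarrow> (nat \<Rightarrow> nat \<Rightarrow> bool) \<Rightarrow> bool" where
  "is_graph n E \<longleftrightarrow> (\<forall>u<n. \<forall>v<n. E u v \<longleftrightarrow> E v u) \<and> (\<forall>u<n. \<not> E u u)"

definition split_graph :: "nat \<Rightarrow> (nat \<Rightarrow> nat \<Rightarrow> bool) \<Rightarrow> bool" where
  "split_graph n E \<longleftrightarrow> (\<exists>K I. K \<union> I = {0..<n} \<and> K \<inter> I = {} \<and>
      (\<forall>u\<in>K. \<forall>v\<in>K. u \<noteq> v \<longrightarrow> E u v) \<and> (\<forall>u\<in>I. \<forall>v\<in>I. \<not> E u v))"

definition connected_induced :: "(nat \<Rightarrow> nat \<Rightarrow> bool) \<Rightarrow> nat set \<Rightarrow> bool" where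
  "connected_induced E S \<longleftrightarrow> S \<noteq> {} \<and>
     (\<forall>u\<in>S. \<forall>v\<in>S. (\<lambda>x y. x \<in> S \<and> y \<in> S \<and> E x y)\<^sup>*\<^sup>* u v)"

definition is_cds :: "nat \<Rightarrow> (nat \<Rightarrow> nat \<Rightarrow> bool) \<Rightarrow> nat set \<Rightarrow> bool" where
  "is_cds n E S \<longleftrightarrow> S \<subseteq> {0..<n} \<and> (\<forall>v\<in>{0..<n} - S. \<exists>u\<in>S. E v u) \<and> connected_induced E S"

definition is_min_cds :: "nat \<Rightarrow> (nat \<Rightarrow> nat \<Rightarrow> bool) \<Rightarrow> nat set \<Rightarrow> bool" where
  "is_min_cds n E S \<longleftrightarrow> is_cds n E S \<and> (\<forall>S'. S' \<subset> S \<longrightarrow> \<not> is_cds n E S')"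

definition hitting_set :: "'a set \<Rightarrow> 'a set set \<Rightarrow> 'a set \<Rightarrow> bool" where
  "hitting_set X \<S> H \<longleftrightarrow> H \<subseteq> X \<and> (\<forall>S\<in>\<S>. H \<inter> S \<noteq> {})"

definition min_hitting_set :: "'a set \<Rightarrow> 'a set set \<Rightarrow> 'a set \<Rightarrow> bool" where
  "min_hitting_set X \<S> H \<longleftrightarrow> hitting_set X \<S> H \<and> (\<forall>H'. H' \<subset> H \<longrightarrow> \<not> hitting_set X \<S> H')"

definition charvec :: "nat \<Rightarrow> nat set \<Rightarrow> bool list" where
  "charvec n S = map (\<lambda>i. i \<in> S) [0..<n]"

definition enc_graph :: "nat \<Rightarrow> (nat \<Rightarrow> nat \<Rightarrow> bool) \<Rightarrow> bool list" where
  "enc_graph n E = replicate n True @ [False] @ concat (map (\<lambda>i. map (\<lambda>j. E i j) [0..<n]) [0..<n])"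

definition enc_hyp :: "nat \<Rightarrow> nat set list \<Rightarrow> bool list" where
  "enc_hyp n Ss = replicate n True @ [False] @ concat (map (\<lambda>S. True # charvec n S) Ss)"

datatype sym = Zero | One | Blank
datatype dir = MoveL | MoveR | Stay
datatype osym = OZero | OOne | OSep

text \<open>States are 0..<tm_states; 0 is the start state, 1 the halting state.
 Each transition may append one symbol to the (write-only) output stream;
 OSep terminates an output solution.\<close>
record tm =
  tm_states :: nat
  tm_delta :: "nat \<Rightarrow> sym \<Rightarrow> nat \<times> sym \<times> dir \<times> osym option"

definition tm_wf :: "tm \<Rightarrow> bool" where
  "tm_wf M \<longleftrightarrow> 2 \<le> tm_states M \<and> (\<forall>q<tm_states M. \<forall>a. fst (tm_delta M q a) < tm_states M)"

type_synonym config = "nat \<times> (int \<Rightarrow> sym) \<times> int"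

definition sym_of_bool :: "bool \<Rightarrow> sym" where
  "sym_of_bool b = (if b then One else Zero)"

definition osym_of_bool :: "bool \<Rightarrow> osym" where
  "osym_of_bool b = (if b then OOne else OZero)"

definition init_conf :: "bool list \<Rightarrow> config" where
  "init_conf w = (0, (\<lambda>i. if 0 \<le> i \<and> i < int (length w) then sym_of_bool (w ! nat i) else Blank), 0)"

definition halted :: "config \<Rightarrow> bool" where
  "halted c \<longleftrightarrow> fst c = 1"

definition move :: "dir \<Rightarrow> int" where
  "move d = (case d of MoveL \<Rightarrow> -1 | MoveR \<Rightarrow> 1 | Stay \<Rightarrow> 0)"

definition step :: "tm \<Rightarrow> config \<Rightarrow> config" where
  "step M c = (case c of (q, tape, pos) \<Rightarrow>
     if q = 1 then c else
     (case tm_delta M q (tape pos) of (q', a, d, _) \<Rightarrow> (q', tape(pos := a), pos + move d)))"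

definition emit :: "tm \<Rightarrow> config \<Rightarrow> osym option" where
  "emit M c = (case c of (q, tape, pos) \<Rightarrow>
     if q = 1 then None else (case tm_delta M q (tape pos) of (_, _, _, out) \<Rightarrow> out))"

definition conf :: "tm \<Rightarrow> bool list \<Rightarrow> nat \<Rightarrow> config" where
  "conf M w t = (step M ^^ t) (init_conf w)"

definition tm_output :: "tm \<Rightarrow> bool list \<Rightarrow> nat \<Rightarrow> osym list" where
  "tm_output M w t = concat (map (\<lambda>i. case emit M (conf M w i) of None \<Rightarrow> [] | Some s \<Rightarrow> [s]) [0..<t])"

text \<open>M on input w halts at time T, having output every word of P exactly once
 (each terminated by OSep), and the time before the first output, between
 consecutive outputs, and after the last output until halting is at most
 c * (|w|+1)^k.\<close>
definition enum_poly_delay :: "tm \<Rightarrow> nat \<Rightarrow> nat \<Rightarrow> bool list \<Rightarrow> bool list set \<Rightarrow> bool" where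
  "enum_poly_delay M c k w P \<longleftrightarrow>
     (\<exists>T. halted (conf M w T) \<and> (\<forall>t<T. \<not> halted (conf M w t)) \<and>
        (\<exists>L. distinct L \<and> set L = P \<and>
             tm_output M w T = concat (map (\<lambda>x. map osym_of_bool x @ [OSep]) L)) \<and>
        (\<forall>t<T. \<exists>s. t < s \<and> s \<le> t + c * (length w + 1) ^ k \<and>
             (s = T \<or> emit M (conf M w (s - 1)) = Some OSep)))"

definition enumerates_min_cds_split_poly_delay :: "tm \<Rightarrow> nat \<Rightarrow> nat \<Rightarrow> bool" where
  "enumerates_min_cds_split_poly_delay M c k \<longleftrightarrow> tm_wf M \<and>
     (\<forall>n E. is_graph n E \<and> split_graph n E \<longrightarrow>
        enum_poly_delay M c k (enc_graph n E) {charvec n S | S. is_min_cds n E S})"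

definition enumerates_min_hs_poly_delay :: "tm \<Rightarrow> nat \<Rightarrow> nat \<Rightarrow> bool" where
  "enumerates_min_hs_poly_delay M c k \<longleftrightarrow> tm_wf M \<and>
     (\<forall>n Ss. (\<forall>S\<in>set Ss. S \<subseteq> {0..<n}) \<longrightarrow>
        enum_poly_delay M c k (enc_hyp n Ss) {charvec n H | H. min_hitting_set {0..<n} (set Ss) H})"

end

theory Submission
  imports Defs
begin

text \<open>A hypergraph with vertex set \<open>{0..<n}\<close> is turned into a split graph whose clique part contains
  the hypergraph vertices and whose independent part contains a vertex for every hyperedge,
  adjacent to the members of that hyperedge. In a split graph with at least two independent
  vertices, the minimal connected dominating sets are exactly the minimal hitting sets, inside the
  clique, of the neighbourhoods of the independent vertices. Pendant vertices force certain clique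
  vertices into every solution; these are placed so that a finite-state filter can restore a minimal
  hitting set from the bits of a minimal connected dominating set.

  The machine for hitting sets first computes the encoding of the graph at the start of an
  otherwise blank tape, and then runs the given enumerator step by step with the filter attached to
  its output. So the delay grows only by the polynomial time of the first phase. That one tape
  with three symbols suffices for the first phase follows by compiling a program with finitely many
  variables for input positions; since its loops only range over input positions, it runs in
  polynomial time.\<close>

section \<open>Structured programs for one-tape machines\<close>

text \<open>The graph has four vertices per input position, not one per hypergraph vertex and
  hyperedge, because the loops of the printing program range over input positions; the surplus must
  be made harmless. A surplus clique vertex is either forced into every solution or adjacent to no
  independent vertex, and then in no minimal one; a surplus independent vertex only repeats a
  forcing constraint. Two independent vertices matter because a lone one adjacent to the whole
  clique would itself be a connected dominating set outside the clique. The enumerator emits its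
  vectors bit by bit and the machine has nowhere to store them, so a finite control must judge each
  bit from its surroundings: bit \<open>4 * h\<close> is followed by bit \<open>4 * h + 1\<close>,
  which is set iff \<open>h < n\<close>. Separators pass the filter in the step in which they arrive
  and decoding is injective on solutions, so no output is lost or repeated and the gaps between
  outputs do not change.\<close>

type_synonym scan = "(int \<Rightarrow> sym) \<times> int"

datatype micro =
    Act "sym \<Rightarrow> sym \<times> dir"
  | Then micro micro (infixr ";;" 60)
  | IfS "sym \<Rightarrow> bool" micro micro
  | WhileS "sym \<Rightarrow> bool" micro

text \<open>The step counts are exact for the tables built below: sequencing is free, because the
  exit state of the first part is the start state of the second, and every test costs one step that
  rewrites the scanned symbol and stays.\<close>

inductive mrun :: "micro \<Rightarrow> scan \<Rightarrow> nat \<Rightarrow> scan \<Rightarrow> bool" where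
  act: "mrun (Act f) (T, p) 1 (T(p := fst (f (T p))), p + move (snd (f (T p))))"
| seq: "mrun c s t s' \<Longrightarrow> mrun d s' t' s'' \<Longrightarrow> mrun (c ;; d) s (t + t') s''"
| if_true: "P (T p) \<Longrightarrow> mrun c (T, p) t s \<Longrightarrow> mrun (IfS P c d) (T, p) (Suc t) s"
| if_false: "\<not> P (T p) \<Longrightarrow> mrun d (T, p) t s \<Longrightarrow> mrun (IfS P c d) (T, p) (Suc t) s"
| while_false: "\<not> P (T p) \<Longrightarrow> mrun (WhileS P c) (T, p) 1 (T, p)"
| while_true: "P (T p) \<Longrightarrow> mrun c (T, p) t s \<Longrightarrow> mrun (WhileS P c) s t' s' \<Longrightarrow>
    mrun (WhileS P c) (T, p) (Suc (t + t')) s'"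

type_synonym table = "nat \<Rightarrow> sym \<Rightarrow> nat \<times> sym \<times> dir"

definition fstep :: "table \<Rightarrow> config \<Rightarrow> config" where
  "fstep \<delta> = (\<lambda>(q, T, p). case \<delta> q (T p) of (q', a, d) \<Rightarrow> (q', T(p := a), p + move d))"

text \<open>Every configuration before the last has a state below \<open>n\<close>. The run
  therefore never leaves the table, which is what permits copying the table into a larger
  one.\<close>

inductive freach :: "table \<Rightarrow> nat \<Rightarrow> config \<Rightarrow> nat \<Rightarrow> config \<Rightarrow> bool" for \<delta> n where
  refl: "freach \<delta> n c 0 c"
| step: "fst c < n \<Longrightarrow> freach \<delta> n (fstep \<delta> c) t c' \<Longrightarrow> freach \<delta> n c (Suc t) c'"

lemma freach_trans:
  "freach \<delta> n c t c' \<Longrightarrow> freach \<delta> n c' t' c'' \<Longrightarrow> freach \<delta> n c (t + t') c''"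
  by (induction rule: freach.induct) (auto intro: freach.intros)

text \<open>The hypothesis says nothing about \<open>g n\<close>: the exit state may be glued to any
  state of the larger table, be it the start of the next part, a common exit or the head of a
  loop.\<close>

lemma freach_embed:
  assumes "freach \<delta> n c t c'"
    and "\<And>q a. q < n \<Longrightarrow> g q < n' \<and> \<delta>' (g q) a = apfst g (\<delta> q a)"
  shows "freach \<delta>' n' (apfst g c) t (apfst g c')"
  using assms(1)
proof (induction rule: freach.induct)
  case (step c t c')
  obtain q T p where c: "c = (q, T, p)" by (cases c)
  have "fstep \<delta>' (apfst g c) = apfst g (fstep \<delta> c)"
    using assms(2)[of q "T p"] step.hyps(1) c
    by (auto simp: fstep_def split: prod.splits)
  then show ?case
    using step assms(2)[of q] c by (auto intro!: freach.step)
qed (auto intro: freach.refl)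

definition implements :: "table \<Rightarrow> nat \<Rightarrow> micro \<Rightarrow> bool" where
  "implements \<delta> n c \<longleftrightarrow> 0 < n \<and> (\<forall>q<n. \<forall>a. fst (\<delta> q a) \<le> n) \<and>
     (\<forall>T p t T' p'. mrun c (T, p) t (T', p') \<longrightarrow> freach \<delta> n (0, T, p) t (n, T', p'))"

lemma implements_Act: "\<exists>\<delta>. implements \<delta> 1 (Act f)"
proof -
  have "implements (\<lambda>q a. (1, f a)) 1 (Act f)"
    unfolding implements_def
    by (auto elim!: mrun.cases intro!: freach.intros simp: fstep_def split: prod.splits)
  then show ?thesis by blast
qed

text \<open>Shifting the second table by \<open>n1\<close> makes its start state coincide with the
  exit state of the first.\<close>

lemma implements_Then:
  assumes 1: "implements \<delta>1 n1 c" and 2: "implements \<delta>2 n2 d"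
  shows "\<exists>\<delta> n. implements \<delta> n (c ;; d)"
proof -
  define \<delta> :: table where
    "\<delta> = (\<lambda>q a. if q < n1 then \<delta>1 q a else apfst (\<lambda>q. q + n1) (\<delta>2 (q - n1) a))"
  have "freach \<delta> (n1 + n2) (0, T, p) t (n1 + n2, T', p')"
    if run: "mrun (c ;; d) (T, p) t (T', p')" for T p t T' p'
  proof -
    from run obtain t1 t2 T1 p1 where r: "mrun c (T, p) t1 (T1, p1)"
        "mrun d (T1, p1) t2 (T', p')" and t: "t = t1 + t2"
      by (auto elim!: mrun.cases[of "c ;; d"])
    have "freach \<delta> (n1 + n2) (apfst id (0, T, p)) t1 (apfst id (n1, T1, p1))"
      by (rule freach_embed[where \<delta> = \<delta>1 and n = n1])
        (use 1 r in \<open>auto simp: \<delta>_def implements_def\<close>)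
    moreover have "freach \<delta> (n1 + n2) (apfst (\<lambda>q. q + n1) (0, T1, p1)) t2
        (apfst (\<lambda>q. q + n1) (n2, T', p'))"
      by (rule freach_embed[where \<delta> = \<delta>2 and n = n2])
        (use 2 r in \<open>auto simp: \<delta>_def implements_def\<close>)
    ultimately show ?thesis
      using freach_trans by (fastforce simp: t add.commute)
  qed
  moreover have "fst (\<delta> q a) \<le> n1 + n2" if "q < n1 + n2" for q a
    using that 1 2 by (auto simp: \<delta>_def implements_def trans_le_add1)
  ultimately have "implements \<delta> (n1 + n2) (c ;; d)"
    using 1 unfolding implements_def by auto
  then show ?thesis by blast
qed

text \<open>State 0 performs the test, followed by the states of \<open>c\<close> and then those of
  \<open>d\<close>. The map \<open>g1\<close> redirects the exit of \<open>c\<close> to the common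
  exit \<open>N\<close>; \<open>g2\<close> reaches \<open>N\<close> by itself, since
  \<open>g2 n2 = N\<close>.\<close>

lemma implements_IfS:
  assumes 1: "implements \<delta>1 n1 c" and 2: "implements \<delta>2 n2 d"
  shows "\<exists>\<delta> n. implements \<delta> n (IfS P c d)"
proof -
  define N where "N = Suc (n1 + n2)"
  define g1 where "g1 q = (if q < n1 then Suc q else N)" for q
  define g2 where "g2 q = Suc (n1 + q)" for q
  define \<delta> :: table where
    "\<delta> = (\<lambda>q a. if q = 0 then (if P a then 1 else Suc n1, a, Stay)
       else if q \<le> n1 then apfst g1 (\<delta>1 (q - 1) a)
       else apfst g2 (\<delta>2 (q - Suc n1) a))"
  have first: "fstep \<delta> (0, T, p) = (if P (T p) then 1 else Suc n1, T, p)" for T p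
    by (auto simp: fstep_def \<delta>_def move_def)
  have c: "freach \<delta> N (1, T, p) t (N, T', p')" if "mrun c (T, p) t (T', p')" for T p t T' p'
  proof -
    have "freach \<delta> N (apfst g1 (0, T, p)) t (apfst g1 (n1, T', p'))"
      by (rule freach_embed[where \<delta> = \<delta>1 and n = n1])
        (use 1 that in \<open>auto simp: \<delta>_def g1_def N_def implements_def\<close>)
    then show ?thesis using 1 by (auto simp: g1_def implements_def)
  qed
  have d: "freach \<delta> N (Suc n1, T, p) t (N, T', p')" if "mrun d (T, p) t (T', p')" for T p t T' p'
  proof -
    have "freach \<delta> N (apfst g2 (0, T, p)) t (apfst g2 (n2, T', p'))"
      by (rule freach_embed[where \<delta> = \<delta>2 and n = n2])
        (use 2 that in \<open>auto simp: \<delta>_def g2_def N_def implements_def\<close>)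
    then show ?thesis by (auto simp: g2_def N_def)
  qed
  have "freach \<delta> N (0, T, p) t (N, T', p')"
    if run: "mrun (IfS P c d) (T, p) t (T', p')" for T p t T' p'
    using run by (cases rule: mrun.cases)
      (use c d in \<open>auto intro!: freach.step simp: first N_def\<close>)
  moreover have "fst (\<delta> q a) \<le> N" if "q < N" for q a
    using that 2 by (auto simp: \<delta>_def N_def g1_def g2_def implements_def)
  ultimately have "implements \<delta> N (IfS P c d)"
    unfolding implements_def by (auto simp: N_def)
  then show ?thesis by blast
qed

lemma implements_WhileS:
  assumes 1: "implements \<delta>1 n1 c"
  shows "\<exists>\<delta> n. implements \<delta> n (WhileS P c)"
proof -
  define N where "N = Suc n1"
  \<comment> \<open>The exit of the body is glued to state 0, where the test is made again.\<close>
  define g where "g q = (if q < n1 then Suc q else 0)" for q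
  define \<delta> :: table where
    "\<delta> = (\<lambda>q a. if q = 0 then (if P a then 1 else N, a, Stay) else apfst g (\<delta>1 (q - 1) a))"
  have first: "fstep \<delta> (0, T, p) = (if P (T p) then 1 else N, T, p)" for T p
    by (auto simp: fstep_def \<delta>_def move_def)
  have body: "freach \<delta> N (1, T, p) t (0, T', p')" if "mrun c (T, p) t (T', p')" for T p t T' p'
  proof -
    have "freach \<delta> N (apfst g (0, T, p)) t (apfst g (n1, T', p'))"
      by (rule freach_embed[where \<delta> = \<delta>1 and n = n1])
        (use 1 that in \<open>auto simp: \<delta>_def g_def N_def implements_def\<close>)
    then show ?thesis using 1 by (auto simp: g_def implements_def)
  qed
  have loop: "freach \<delta> N (0, s) t (N, s')" if "mrun (WhileS P c) s t s'" for s t s'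
    using that
  proof (induction "WhileS P c" s t s' rule: mrun.induct)
    case (while_false T p)
    have "freach \<delta> N (0, T, p) (Suc 0) (N, T, p)"
      by (rule freach.step) (use while_false in \<open>auto simp: first N_def intro: freach.refl\<close>)
    then show ?case by simp
  next
    case (while_true T p t s t' s')
    obtain T1 p1 where s: "s = (T1, p1)" by (cases s)
    have "freach \<delta> N (1, T, p) (t + t') (N, s')"
      using freach_trans body while_true s by blast
    then show ?case
      using while_true by (intro freach.step) (auto simp: first N_def)
  qed
  moreover have "fst (\<delta> q a) \<le> N" if "q < N" for q a
    using that 1 by (auto simp: \<delta>_def N_def g_def implements_def)
  ultimately have "implements \<delta> N (WhileS P c)"
    unfolding implements_def by (auto simp: N_def)
  then show ?thesis by blast
qed

theorem micro_implementable: "\<exists>\<delta> n. implements \<delta> n c"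
proof (induction c)
  case (Act f)
  then show ?case using implements_Act by blast
next
  case (Then c d)
  then show ?case using implements_Then by blast
next
  case (IfS P c d)
  then show ?case using implements_IfS by blast
next
  case (WhileS P c)
  then show ?case using implements_WhileS by blast
qed

section \<open>Simulating multi-head programs on one tape\<close>

definition runs :: "micro \<Rightarrow> scan \<Rightarrow> nat \<Rightarrow> scan \<Rightarrow> bool" where
  "runs c s B s' \<longleftrightarrow> (\<exists>t\<le>B. mrun c s t s')"

lemma runs_mono: "runs c s B s' \<Longrightarrow> B \<le> B' \<Longrightarrow> runs c s B' s'"
  unfolding runs_def by (meson le_trans)

lemma runs_seq: "runs c s B s' \<Longrightarrow> runs d s' B' s'' \<Longrightarrow> B + B' \<le> C \<Longrightarrow> runs (c ;; d) s C s''"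
  unfolding runs_def by (meson add_le_mono le_trans mrun.seq)

lemmas runs_seqI = runs_seq[OF _ _ order.refl]

lemma runs_if_true: "P (T p) \<Longrightarrow> runs c (T, p) B s \<Longrightarrow> Suc B \<le> C \<Longrightarrow> runs (IfS P c d) (T, p) C s"
  unfolding runs_def by (meson Suc_le_mono le_trans mrun.if_true)

lemma runs_if_false: "\<not> P (T p) \<Longrightarrow> runs d (T, p) B s \<Longrightarrow> Suc B \<le> C \<Longrightarrow> runs (IfS P c d) (T, p) C s"
  unfolding runs_def by (meson Suc_le_mono le_trans mrun.if_false)

lemma runs_while_false: "\<not> P (T p) \<Longrightarrow> 1 \<le> C \<Longrightarrow> runs (WhileS P c) (T, p) C (T, p)"
  unfolding runs_def using mrun.while_false by blast

lemma runs_while_true: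
  assumes "P (T p)" "runs c (T, p) B s" "runs (WhileS P c) s B' s'" "Suc (B + B') \<le> C"
  shows "runs (WhileS P c) (T, p) C s'"
proof -
  from assms(2,3) obtain t t' where "t \<le> B" "mrun c (T, p) t s" "t' \<le> B'" "mrun (WhileS P c) s t' s'"
    unfolding runs_def by blast
  then have "mrun (WhileS P c) (T, p) (Suc (t + t')) s'" "Suc (t + t') \<le> C"
    using assms mrun.while_true by auto
  then show ?thesis unfolding runs_def by blast
qed

text \<open>The tape is split into a work area, whose cell number \<open>m\<close> is at position \<open>-1 - m\<close>,
  and an output area that starts at position 0.\<close>

definition lpos :: "nat \<Rightarrow> int" where
  "lpos m = -1 - int m"

definition layout :: "(nat \<Rightarrow> sym) \<Rightarrow> bool list \<Rightarrow> int \<Rightarrow> sym" where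
  "layout W out = (\<lambda>i. if i < 0 then W (nat (-1 - i))
     else if nat i < length out then sym_of_bool (out ! nat i) else Blank)"

lemma layout_lpos [simp]: "layout W out (lpos m) = W m"
  by (simp add: layout_def lpos_def)

lemma layout_upd_lpos: "(layout W out)(lpos m := a) = layout (W(m := a)) out"
proof
  fix i
  show "((layout W out)(lpos m := a)) i = layout (W(m := a)) out i"
    by (cases "i < 0") (auto simp: layout_def lpos_def)
qed

lemma sym_of_bool_simps [simp]:
  "sym_of_bool b \<noteq> Blank" "Blank \<noteq> sym_of_bool b"
  "sym_of_bool b = sym_of_bool b' \<longleftrightarrow> b = b'"
  by (auto simp: sym_of_bool_def)

text \<open>There is no empty program, so the base case is an idle step and \<open>mvn d n\<close>
  takes \<open>n + 1\<close> steps.\<close>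

primrec mvn :: "dir \<Rightarrow> nat \<Rightarrow> micro" where
  "mvn d 0 = Act (\<lambda>a. (a, Stay))"
| "mvn d (Suc n) = Act (\<lambda>a. (a, d)) ;; mvn d n"

definition wr :: "sym \<Rightarrow> micro" where
  "wr s = Act (\<lambda>_. (s, Stay))"

lemma runs_act: "T' = T(p := fst (f (T p))) \<Longrightarrow> p' = p + move (snd (f (T p))) \<Longrightarrow> 1 \<le> C \<Longrightarrow>
    runs (Act f) (T, p) C (T', p')"
  unfolding runs_def using mrun.act by blast

lemma runs_mvn: "runs (mvn d n) (T, p) (Suc n) (T, p + int n * move d)"
proof (induction n arbitrary: p)
  case 0
  show ?case by (auto intro!: runs_act simp: move_def)
next
  case (Suc n)
  have "runs (mvn d (Suc n)) (T, p) (Suc (Suc n)) (T, (p + move d) + int n * move d)"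
    unfolding mvn.simps by (rule runs_seq[OF runs_act Suc.IH]) auto
  then show ?case by (simp add: algebra_simps)
qed

lemma runs_left: "Suc n \<le> C \<Longrightarrow> q = m + n \<Longrightarrow> runs (mvn MoveL n) (T, lpos m) C (T, lpos q)"
  using runs_mono[OF runs_mvn[of MoveL n T "lpos m"]] by (simp add: move_def lpos_def algebra_simps)

lemma runs_right: "Suc n \<le> C \<Longrightarrow> m = q + n \<Longrightarrow> runs (mvn MoveR n) (T, lpos m) C (T, lpos q)"
  using runs_mono[OF runs_mvn[of MoveR n T "lpos m"]] by (simp add: move_def lpos_def algebra_simps)

lemma runs_wr: "1 \<le> C \<Longrightarrow> runs (wr s) (layout W out, lpos m) C (layout (W(m := s)) out, lpos m)"
  unfolding wr_def by (rule runs_act) (auto simp: layout_upd_lpos move_def)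

text \<open>Strides of \<open>n\<close> cells let the head inspect one residue class of positions
  and ignore all symbols between. One stride costs \<open>n + 1\<close> moves and a test.\<close>

lemma runs_walk:
  assumes "\<And>i. i < j \<Longrightarrow> P (T (p + int i * (int n * move d)))"
    and "\<not> P (T (p + int j * (int n * move d)))"
  shows "runs (WhileS P (mvn d n)) (T, p) (Suc (j * (n + 2))) (T, p + int j * (int n * move d))"
  using assms
proof (induction j arbitrary: p)
  case 0
  then show ?case by (auto intro!: runs_while_false)
next
  case (Suc j)
  have eq: "p + int n * move d + int i * (int n * move d) = p + int (Suc i) * (int n * move d)" for i
    by (simp add: algebra_simps)
  have rest: "runs (WhileS P (mvn d n)) (T, p + int n * move d) (Suc (j * (n + 2)))
      (T, p + int n * move d + int j * (int n * move d))"
    by (rule Suc.IH; unfold eq; rule Suc.prems) simp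
  have "P (T p)" using Suc.prems(1)[of 0] by simp
  then show ?case
    by (rule runs_while_true[OF _ runs_mvn rest[unfolded eq]]) simp
qed

lemma runs_walk_left:
  assumes "\<And>i. i < j \<Longrightarrow> P (W (m + i * n))" and "\<not> P (W (m + j * n))"
    and "q = m + j * n" and "Suc (j * (n + 2)) \<le> C"
  shows "runs (WhileS P (mvn MoveL n)) (layout W out, lpos m) C (layout W out, lpos q)"
proof -
  have eq: "lpos m + int i * (int n * move MoveL) = lpos (m + i * n)" for i
    by (simp add: lpos_def move_def algebra_simps)
  show ?thesis
    using runs_walk[of j P "layout W out" "lpos m" n MoveL] assms runs_mono
    unfolding eq by auto
qed

lemma runs_walk_right:
  assumes "\<And>i. i < j \<Longrightarrow> P (W (q + (j - i) * n))" and "\<not> P (W q)"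
    and "m = q + j * n" and "Suc (j * (n + 2)) \<le> C"
  shows "runs (WhileS P (mvn MoveR n)) (layout W out, lpos m) C (layout W out, lpos q)"
proof -
  have eq: "lpos m + int i * (int n * move MoveR) = lpos (q + (j - i) * n)" if "i \<le> j" for i
    using that assms(3) by (simp add: lpos_def move_def left_diff_distrib)
  show ?thesis
    using runs_walk[of j P "layout W out" "lpos m" n MoveR] assms runs_mono eq by auto
qed

text \<open>Work cell 0 is the separator. Block \<open>j\<close> consists of the cells \<open>j * k + 1, \<dots>, (j + 1) * k\<close>:
  cell \<open>j * k + h\<close> with \<open>0 < h < k\<close> is marked iff variable \<open>h\<close> has the value \<open>j\<close>,
  and cell \<open>(j + 1) * k\<close> holds the data bit \<open>v ! j\<close>. The cells to the left of the data are
  blank, so that block \<open>length v\<close>, on which a variable may stand too, needs no allocation.\<close>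

definition work :: "nat \<Rightarrow> bool list \<Rightarrow> (nat \<Rightarrow> nat) \<Rightarrow> nat \<Rightarrow> sym" where
  "work k v p m =
    (if m mod k = 0 then (if 0 < m div k \<and> m div k \<le> length v then sym_of_bool (v ! (m div k - 1)) else Blank)
     else if p (m mod k) = m div k then One else Blank)"

lemma work_mark: "0 < h \<Longrightarrow> h < k \<Longrightarrow> work k v p (j * k + h) = (if p h = j then One else Blank)"
  "0 < h \<Longrightarrow> h < k \<Longrightarrow> work k v p (h + j * k) = (if p h = j then One else Blank)"
  by (simp_all add: work_def)

lemma work_data: "0 < k \<Longrightarrow> work k v p (j * k) =
    (if 0 < j \<and> j \<le> length v then sym_of_bool (v ! (j - 1)) else Blank)"
  by (simp add: work_def)

lemma work_0 [simp]: "work k v p 0 = Blank"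
  by (simp add: work_def)

lemma work_upd:
  assumes "0 < h" "h < k"
  shows "(work k v p)(p h * k + h := Blank, j * k + h := One) = work k v (p(h := j))"
proof
  fix m
  have m: "m = i * k + h \<longleftrightarrow> m mod k = h \<and> m div k = i" for i
    using assms by (metis add.commute div_mult_mod_eq div_mult_self1 mod_mult_self1 mod_less div_less
        add.left_neutral not_less_zero)
  show "((work k v p)(p h * k + h := Blank, j * k + h := One)) m = work k v (p(h := j)) m"
    using assms by (auto simp: work_def m)
qed

text \<open>Starting at the separator, the strides of length \<open>k\<close> meet only mark cells
  of variable \<open>h\<close>; the search ends at its unique mark, and the last two moves switch to
  cell \<open>r\<close> of the same block.\<close>

definition goto_mark :: "nat \<Rightarrow> nat \<Rightarrow> nat \<Rightarrow> micro" where
  "goto_mark k h r = mvn MoveL h ;; WhileS (\<lambda>a. a \<noteq> One) (mvn MoveL k) ;; mvn MoveR h ;; mvn MoveL r"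

text \<open>The cells \<open>i * k\<close> with \<open>0 < i\<close> hold data bits and cell 0 is
  blank, so strides over the multiples of \<open>k\<close> stop exactly at the separator.\<close>

definition return_home :: "nat \<Rightarrow> nat \<Rightarrow> micro" where
  "return_home k r = mvn MoveR r ;; WhileS (\<lambda>a. a \<noteq> Blank) (mvn MoveR k)"

definition unit_time :: "nat \<Rightarrow> nat \<Rightarrow> nat" where
  "unit_time k U = (U + 2) * (k + 2)"

lemma unit_time_ge: "r \<le> k \<Longrightarrow> Suc r \<le> unit_time k U"
  "j \<le> U \<Longrightarrow> Suc (j * (k + 2)) \<le> unit_time k U" "1 \<le> unit_time k U" "Suc 0 \<le> unit_time k U"
proof -
  show "r \<le> k \<Longrightarrow> Suc r \<le> unit_time k U" by (simp add: unit_time_def algebra_simps)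
  show "1 \<le> unit_time k U" "Suc 0 \<le> unit_time k U" by (simp_all add: unit_time_def algebra_simps)
  assume "j \<le> U"
  then have "j * (k + 2) \<le> U * (k + 2)" by (rule mult_le_mono1)
  then show "Suc (j * (k + 2)) \<le> unit_time k U" by (simp add: unit_time_def algebra_simps)
qed

lemma runs_goto_mark:
  assumes "\<And>i. W (h + i * k) = One \<longleftrightarrow> i = j" and "h \<le> k" "r \<le> k" "j \<le> U"
    and "4 * unit_time k U \<le> C" "q = j * k + r"
  shows "runs (goto_mark k h r) (layout W out, lpos 0) C (layout W out, lpos q)"
proof -
  let ?X = "unit_time k U"
  have "runs (mvn MoveL h) (layout W out, lpos 0) ?X (layout W out, lpos h)"
    by (rule runs_left) (use assms unit_time_ge in auto)
  moreover have "runs (WhileS (\<lambda>a. a \<noteq> One) (mvn MoveL k)) (layout W out, lpos h) ?X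
      (layout W out, lpos (h + j * k))"
    by (rule runs_walk_left[where j = j]) (use assms unit_time_ge in auto)
  moreover have "runs (mvn MoveR h) (layout W out, lpos (h + j * k)) ?X (layout W out, lpos (j * k))"
    by (rule runs_right) (use assms unit_time_ge in auto)
  moreover have "runs (mvn MoveL r) (layout W out, lpos (j * k)) ?X (layout W out, lpos q)"
    by (rule runs_left) (use assms unit_time_ge in auto)
  ultimately have "runs (goto_mark k h r) (layout W out, lpos 0) (?X + (?X + (?X + ?X))) (layout W out, lpos q)"
    unfolding goto_mark_def by (intro runs_seq[OF _ _ order.refl])
  then show ?thesis by (rule runs_mono) (use assms(5) in simp)
qed

lemma runs_return_home:
  assumes "\<And>i. 0 < i \<Longrightarrow> i \<le> j \<Longrightarrow> W (i * k) \<noteq> Blank" "W 0 = Blank" and "r \<le> k" "j \<le> U"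
    and "2 * unit_time k U \<le> C" "q = j * k + r"
  shows "runs (return_home k r) (layout W out, lpos q) C (layout W out, lpos 0)"
proof -
  let ?X = "unit_time k U"
  have "runs (mvn MoveR r) (layout W out, lpos q) ?X (layout W out, lpos (j * k))"
    by (rule runs_right) (use assms unit_time_ge in auto)
  moreover have "runs (WhileS (\<lambda>a. a \<noteq> Blank) (mvn MoveR k)) (layout W out, lpos (j * k)) ?X
      (layout W out, lpos 0)"
    by (rule runs_walk_right[where j = j]) (use assms unit_time_ge in auto)
  ultimately show ?thesis
    unfolding return_home_def by (rule runs_seq) (use assms in simp)
qed

section \<open>A language with finitely many variables for input positions\<close>

datatype com =
    Skip
  | Copy nat nat
  | Inc nat
  | Out bool
  | Semi com com
  | IfEq nat nat com com
  | IfBit nat bool com com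
  | Loop nat com

type_synonym cstate = "(nat \<Rightarrow> nat) \<times> bool list"

definition setv :: "nat \<Rightarrow> nat \<Rightarrow> cstate \<Rightarrow> cstate" where
  "setv h j = apfst (\<lambda>p. p(h := j))"

text \<open>Saturation in \<open>Inc\<close> keeps every value at most \<open>length v\<close>,
  hence on one of the blocks provided. The value \<open>length v\<close> is off the input:
  \<open>IfBit\<close> fails there for both bits, and a loop leaves its counter there.\<close>

primrec exec :: "bool list \<Rightarrow> com \<Rightarrow> cstate \<Rightarrow> cstate" where
  "exec v Skip s = s"
| "exec v (Copy a b) s = setv a (fst s b) s"
| "exec v (Inc a) s = setv a (min (Suc (fst s a)) (length v)) s"
| "exec v (Out b) s = apsnd (\<lambda>out. out @ [b]) s"
| "exec v (Semi c d) s = exec v d (exec v c s)"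
| "exec v (IfEq a b c d) s = (if fst s a = fst s b then exec v c s else exec v d s)"
| "exec v (IfBit a b c d) s = (if fst s a < length v \<and> v ! fst s a = b then exec v c s else exec v d s)"
| "exec v (Loop h c) s = setv h (length v) (fold (\<lambda>j s. exec v c (setv h j s)) [0..<length v] s)"

primrec writes :: "com \<Rightarrow> nat set" where
  "writes Skip = {}"
| "writes (Copy a b) = {a}"
| "writes (Inc a) = {a}"
| "writes (Out b) = {}"
| "writes (Semi c d) = writes c \<union> writes d"
| "writes (IfEq a b c d) = writes c \<union> writes d"
| "writes (IfBit a b c d) = writes c \<union> writes d"
| "writes (Loop h c) = insert h (writes c)"

text \<open>Variable 1 is never written and therefore provides the constant 0.\<close>

primrec wfc :: "nat \<Rightarrow> com \<Rightarrow> bool" where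
  "wfc k Skip \<longleftrightarrow> True"
| "wfc k (Copy a b) \<longleftrightarrow> a \<in> {1<..<k} \<and> b \<in> {0<..<k} \<and> a \<noteq> b"
| "wfc k (Inc a) \<longleftrightarrow> a \<in> {1<..<k}"
| "wfc k (Out b) \<longleftrightarrow> True"
| "wfc k (Semi c d) \<longleftrightarrow> wfc k c \<and> wfc k d"
| "wfc k (IfEq a b c d) \<longleftrightarrow> a \<in> {0<..<k} \<and> b \<in> {0<..<k} \<and> wfc k c \<and> wfc k d"
| "wfc k (IfBit a b c d) \<longleftrightarrow> a \<in> {0<..<k} \<and> wfc k c \<and> wfc k d"
| "wfc k (Loop h c) \<longleftrightarrow> h \<in> {1<..<k} \<and> h \<notin> writes c \<and> wfc k c"

text \<open>Counted in units of \<open>op_time\<close>. Since \<open>Out\<close> costs 1, the same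
  number also bounds how many bits are printed.\<close>

primrec cost :: "com \<Rightarrow> nat \<Rightarrow> nat" where
  "cost Skip L = 1"
| "cost (Copy a b) L = 1"
| "cost (Inc a) L = 1"
| "cost (Out b) L = 1"
| "cost (Semi c d) L = cost c L + cost d L"
| "cost (IfEq a b c d) L = 1 + cost c L + cost d L"
| "cost (IfBit a b c d) L = 1 + cost c L + cost d L"
| "cost (Loop h c) L = 2 + L * (cost c L + 2)"

text \<open>The old mark of \<open>a\<close> is erased before the mark of \<open>b\<close> is
  sought. With \<open>a = b\<close> that search would find nothing, which is why \<open>wfc\<close>
  demands \<open>a \<noteq> b\<close>.\<close>

definition copy_micro :: "nat \<Rightarrow> nat \<Rightarrow> nat \<Rightarrow> micro" where
  "copy_micro k a b = goto_mark k a a ;; wr Blank ;; return_home k a ;;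
     goto_mark k b a ;; wr One ;; return_home k a"

definition inc_micro :: "nat \<Rightarrow> nat \<Rightarrow> micro" where
  "inc_micro k a = goto_mark k a k ;; IfS (\<lambda>s. s = Blank) (return_home k k)
     (mvn MoveR k ;; mvn MoveL a ;; wr Blank ;; mvn MoveL k ;; wr One ;; return_home k a)"

definition out_micro :: "bool \<Rightarrow> micro" where
  "out_micro b = mvn MoveR 1 ;; WhileS (\<lambda>a. a \<noteq> Blank) (mvn MoveR 1) ;; wr (sym_of_bool b) ;;
     WhileS (\<lambda>a. a \<noteq> Blank) (mvn MoveL 1)"

text \<open>Equality of two variables means that their marks share a block, so \<open>IfEq\<close>
  walks to the mark of \<open>a\<close> and looks at cell \<open>b\<close> of that block. A loop
  starts by copying the constant 0 from variable 1 and ends when the data cell beside its counter is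
  blank, that is, at block \<open>length v\<close>.\<close>

primrec tr :: "nat \<Rightarrow> com \<Rightarrow> micro" where
  "tr k Skip = mvn MoveL 0"
| "tr k (Copy a b) = copy_micro k a b"
| "tr k (Inc a) = inc_micro k a"
| "tr k (Out b) = out_micro b"
| "tr k (Semi c d) = tr k c ;; tr k d"
| "tr k (IfEq a b c d) = goto_mark k a b ;;
     IfS (\<lambda>s. s = One) (return_home k b ;; tr k c) (return_home k b ;; tr k d)"
| "tr k (IfBit a b c d) = goto_mark k a k ;;
     IfS (\<lambda>s. s = sym_of_bool b) (return_home k k ;; tr k c) (return_home k k ;; tr k d)"
| "tr k (Loop h c) = copy_micro k h 1 ;; goto_mark k h k ;;
     WhileS (\<lambda>a. a \<noteq> Blank) (return_home k k ;; tr k c ;; inc_micro k h ;; goto_mark k h k) ;;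
     return_home k k"

text \<open>The factor 20 is slack: a copy takes 14 units, and in a loop the increment together with
  the search, the return and the test must fit into two operations.\<close>

definition op_time :: "nat \<Rightarrow> nat \<Rightarrow> nat" where
  "op_time k U = 20 * unit_time k U"

lemma runs_goto:
  assumes "0 < h" "h < k" "r \<le> k" "p h \<le> U" "4 * unit_time k U \<le> C"
  shows "runs (goto_mark k h r) (layout (work k v p) out, lpos 0) C
    (layout (work k v p) out, lpos (p h * k + r))"
  by (rule runs_goto_mark[where j = "p h" and U = U]) (use assms in \<open>auto simp: work_mark\<close>)

lemma runs_return:
  assumes "0 < k" "r \<le> k" "j \<le> length v" "length v \<le> U" "2 * unit_time k U \<le> C"
  shows "runs (return_home k r) (layout (work k v p) out, lpos (j * k + r)) C
    (layout (work k v p) out, lpos 0)"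
  by (rule runs_return_home[where j = j and U = U]) (use assms in \<open>auto simp: work_data\<close>)

lemma upd_mark_other:
  fixes j :: nat
  assumes "0 < a" "a < k" 
  shows "(W(j * k + a := s)) (i * k) = W (i * k)" "(W(j * k + a := s)) 0 = W 0"
    "0 < b \<Longrightarrow> b < k \<Longrightarrow> a \<noteq> b \<Longrightarrow> (W(j * k + a := s)) (b + i * k) = W (b + i * k)"
proof -
  have *: "x * k + y = j * k + a \<longleftrightarrow> x = j \<and> y = a" if "y < k" for x y
    using assms that by (metis add.commute div_mult_self1 mod_mult_self1 mod_less div_less
        add.left_neutral not_less_zero)
  show "(W(j * k + a := s)) (i * k) = W (i * k)" using *[of 0 i] assms by auto
  show "(W(j * k + a := s)) 0 = W 0" using assms by auto
  show "0 < b \<Longrightarrow> b < k \<Longrightarrow> a \<noteq> b \<Longrightarrow> (W(j * k + a := s)) (b + i * k) = W (b + i * k)"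
    using *[of b i] by (auto simp: add.commute)
qed

lemma runs_copy_micro:
  assumes "0 < a" "a < k" "0 < b" "b < k" "a \<noteq> b" "p a \<le> length v" "p b \<le> length v" "length v \<le> U"
  shows "runs (copy_micro k a b) (layout (work k v p) out, lpos 0) (op_time k U)
    (layout (work k v (p(a := p b))) out, lpos 0)"
proof -
  let ?X = "unit_time k U"
  let ?W0 = "work k v p"
  let ?W1 = "?W0(p a * k + a := Blank)"
  let ?W2 = "?W1(p b * k + a := One)"
  have "runs (goto_mark k a a) (layout ?W0 out, lpos 0) (4 * ?X) (layout ?W0 out, lpos (p a * k + a))"
    by (rule runs_goto[where U = U]) (use assms in auto)
  moreover have "runs (wr Blank) (layout ?W0 out, lpos (p a * k + a)) ?X (layout ?W1 out, lpos (p a * k + a))"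
    by (rule runs_wr) (rule unit_time_ge)
  moreover have "runs (return_home k a) (layout ?W1 out, lpos (p a * k + a)) (2 * ?X) (layout ?W1 out, lpos 0)"
    by (rule runs_return_home[where j = "p a" and U = U])
      (use assms in \<open>auto simp: work_data upd_mark_other simp del: fun_upd_apply\<close>)
  moreover have "runs (goto_mark k b a) (layout ?W1 out, lpos 0) (4 * ?X) (layout ?W1 out, lpos (p b * k + a))"
    by (rule runs_goto_mark[where j = "p b" and U = U])
      (use assms in \<open>auto simp: work_mark upd_mark_other simp del: fun_upd_apply\<close>)
  moreover have "runs (wr One) (layout ?W1 out, lpos (p b * k + a)) ?X (layout ?W2 out, lpos (p b * k + a))"
    by (rule runs_wr) (rule unit_time_ge)
  moreover have "runs (return_home k a) (layout ?W2 out, lpos (p b * k + a)) (2 * ?X) (layout ?W2 out, lpos 0)"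
    by (rule runs_return_home[where j = "p b" and U = U])
      (use assms in \<open>auto simp: work_data upd_mark_other simp del: fun_upd_apply\<close>)
  ultimately have "runs (copy_micro k a b) (layout ?W0 out, lpos 0)
      (4 * ?X + (?X + (2 * ?X + (4 * ?X + (?X + 2 * ?X))))) (layout ?W2 out, lpos 0)"
    unfolding copy_micro_def by (intro runs_seq[OF _ _ order.refl])
  moreover have "?W2 = work k v (p(a := p b))"
    using assms by (intro work_upd)
  ultimately show ?thesis
    using runs_mono[of "copy_micro k a b" _ "14 * ?X" _ "op_time k U"] by (simp add: op_time_def)
qed

lemma runs_inc_micro:
  assumes "0 < a" "a < k" "p a \<le> length v" "length v \<le> U"
  shows "runs (inc_micro k a) (layout (work k v p) out, lpos 0) (op_time k U)
    (layout (work k v (p(a := min (Suc (p a)) (length v)))) out, lpos 0)"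
proof -
  let ?X = "unit_time k U"
  let ?W0 = "work k v p"
  let ?W1 = "?W0(p a * k + a := Blank)"
  let ?W2 = "?W1(Suc (p a) * k + a := One)"
  have goto: "runs (goto_mark k a k) (layout ?W0 out, lpos 0) (4 * ?X) (layout ?W0 out, lpos (p a * k + k))"
    by (rule runs_goto[where U = U]) (use assms in auto)
  have sym: "?W0 (p a * k + k) = (if p a < length v then sym_of_bool (v ! p a) else Blank)"
    using assms work_data[of k v p "Suc (p a)"] by (simp add: add.commute)
  show ?thesis
  proof (cases "p a < length v")
    case False
    then have "p a = length v" using assms by simp
    then have same: "p(a := min (Suc (p a)) (length v)) = p" by auto
    have "runs (IfS (\<lambda>s. s = Blank) (return_home k k)
       (mvn MoveR k ;; mvn MoveL a ;; wr Blank ;; mvn MoveL k ;; wr One ;; return_home k a))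
       (layout ?W0 out, lpos (p a * k + k)) (Suc (2 * ?X)) (layout ?W0 out, lpos 0)"
      by (rule runs_if_true[OF _ runs_return[OF _ _ _ assms(4)]]) (use assms sym False in auto)
    then show ?thesis
      unfolding inc_micro_def same
      by (rule runs_seq[OF goto]) (use unit_time_ge(3)[of k U] in \<open>simp add: op_time_def\<close>)
  next
    case True
    have W2: "?W2 = work k v (p(a := min (Suc (p a)) (length v)))"
      using work_upd[of a k v p "Suc (p a)"] assms True by (simp add: min_absorb1 Suc_leI)
    have "runs (mvn MoveR k) (layout ?W0 out, lpos (p a * k + k)) ?X (layout ?W0 out, lpos (p a * k))"
      by (rule runs_right) (auto intro: unit_time_ge)
    moreover have "runs (mvn MoveL a) (layout ?W0 out, lpos (p a * k)) ?X (layout ?W0 out, lpos (p a * k + a))"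
      by (rule runs_left) (use assms in \<open>auto intro: unit_time_ge\<close>)
    moreover have "runs (wr Blank) (layout ?W0 out, lpos (p a * k + a)) ?X (layout ?W1 out, lpos (p a * k + a))"
      by (rule runs_wr) (rule unit_time_ge)
    moreover have "runs (mvn MoveL k) (layout ?W1 out, lpos (p a * k + a)) ?X (layout ?W1 out, lpos (Suc (p a) * k + a))"
      by (rule runs_left) (use assms in \<open>auto intro: unit_time_ge\<close>)
    moreover have "runs (wr One) (layout ?W1 out, lpos (Suc (p a) * k + a)) ?X (layout ?W2 out, lpos (Suc (p a) * k + a))"
      by (rule runs_wr) (rule unit_time_ge)
    moreover have "runs (return_home k a) (layout ?W2 out, lpos (Suc (p a) * k + a)) (2 * ?X) (layout ?W2 out, lpos 0)"
      by (rule runs_return_home[where j = "Suc (p a)" and U = U])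
        (use assms True in \<open>auto simp: work_data upd_mark_other simp del: fun_upd_apply mult_Suc\<close>)
    ultimately have "runs (mvn MoveR k ;; mvn MoveL a ;; wr Blank ;; mvn MoveL k ;; wr One ;; return_home k a)
        (layout ?W0 out, lpos (p a * k + k)) (?X + (?X + (?X + (?X + (?X + 2 * ?X))))) (layout ?W2 out, lpos 0)"
      by (intro runs_seq[OF _ _ order.refl])
    then have "runs (IfS (\<lambda>s. s = Blank) (return_home k k)
       (mvn MoveR k ;; mvn MoveL a ;; wr Blank ;; mvn MoveL k ;; wr One ;; return_home k a))
       (layout ?W0 out, lpos (p a * k + k)) (8 * ?X) (layout ?W2 out, lpos 0)"
      by (rule runs_if_false[rotated]) (use sym True unit_time_ge(3)[of k U] in auto)
    then show ?thesis
      unfolding inc_micro_def W2[symmetric]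
      by (rule runs_seq[OF goto]) (simp add: op_time_def)
  qed
qed

lemma runs_out_micro:
  assumes "W 0 = Blank" "length out < U"
  shows "runs (out_micro b) (layout W out, lpos 0) (op_time k U) (layout W (out @ [b]), lpos 0)"
proof -
  let ?n = "length out" and ?T = "layout W out" and ?T' = "layout W (out @ [b])"
  have out: "layout W out (int i) = (if i < length out then sym_of_bool (out ! i) else Blank)" for out i
    by (simp add: layout_def)
  have "runs (mvn MoveR 1) (?T, lpos 0) 2 (?T, 0)"
    using runs_mvn[of MoveR 1 ?T "lpos 0"] by (simp add: lpos_def move_def numeral_2_eq_2)
  moreover have "runs (WhileS (\<lambda>a. a \<noteq> Blank) (mvn MoveR 1)) (?T, 0) (Suc (?n * (1 + 2))) (?T, int ?n)"
    using runs_walk[of ?n "\<lambda>a. a \<noteq> Blank" ?T 0 1 MoveR]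
    by (simp add: move_def out)
  moreover have "runs (wr (sym_of_bool b)) (?T, int ?n) 1 (?T', int ?n)"
    unfolding wr_def by (rule runs_act) (auto simp: layout_def move_def nth_append fun_eq_iff)
  moreover have "runs (WhileS (\<lambda>a. a \<noteq> Blank) (mvn MoveL 1)) (?T', int ?n) (Suc (Suc ?n * (1 + 2))) (?T', lpos 0)"
  proof -
    have "?T' (int ?n - int i) \<noteq> Blank" if "i < Suc ?n" for i
    proof -
      have "int ?n - int i = int (?n - i)" using that by simp
      then show ?thesis by (simp only: out) simp
    qed
    moreover have "?T' (-1) = Blank"
      using assms layout_lpos[of W "out @ [b]" 0] by (simp add: lpos_def)
    ultimately show ?thesis
      using runs_walk[of "Suc ?n" "\<lambda>a. a \<noteq> Blank" ?T' "int ?n" 1 MoveL]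
      by (simp add: move_def lpos_def)
  qed
  ultimately have "runs (out_micro b) (layout W out, lpos 0) (2 + (Suc (?n * (1 + 2)) + (1 + Suc (Suc ?n * (1 + 2)))))
      (layout W (out @ [b]), lpos 0)"
    unfolding out_micro_def by (intro runs_seq[OF _ _ order.refl])
  moreover have "U + 2 \<le> unit_time k U"
    by (simp add: unit_time_def)
  ultimately show ?thesis
    by (elim runs_mono) (use assms in \<open>simp add: op_time_def\<close>)
qed

lemma setv_simps [simp]: "setv h j (p, out) = (p(h := j), out)" "snd (setv h j s) = snd s"
  "fst (setv h j s) = (fst s)(h := j)"
  by (simp_all add: setv_def)

lemma fold_exec_not_written:
  "(\<And>s. fst (f s) h = fst s h) \<Longrightarrow> g \<noteq> h \<Longrightarrow> fst (fold (\<lambda>j s. f (setv g j s)) js s) h = fst s h"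
  by (induction js arbitrary: s) auto

lemma exec_not_written: "h \<notin> writes c \<Longrightarrow> fst (exec v c s) h = fst s h"
  by (induction c arbitrary: s) (auto simp: fold_exec_not_written)

definition valid :: "nat \<Rightarrow> cstate \<Rightarrow> bool" where
  "valid L s \<longleftrightarrow> (\<forall>h. fst s h \<le> L) \<and> fst s 1 = 0"

lemma valid_setv: "valid L s \<Longrightarrow> j \<le> L \<Longrightarrow> 1 < h \<Longrightarrow> valid L (setv h j s)"
  by (auto simp: valid_def)

definition tape :: "nat \<Rightarrow> bool list \<Rightarrow> cstate \<Rightarrow> int \<Rightarrow> sym" where
  "tape k v s = layout (work k v (fst s)) (snd s)"

text \<open>The loop case of the simulation theorem, with the induction hypothesis as the premise
  \<open>body\<close>. The body does not write the counter, so the counter still has the value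
  \<open>j\<close> when it is incremented.\<close>

lemma runs_loop:
  fixes v :: "bool list"
  defines "L \<equiv> length v"
  assumes body: "\<And>s. valid L s \<Longrightarrow> L + length (snd s) + C \<le> U \<Longrightarrow>
      runs (tr k c) (tape k v s, lpos 0) (C * op_time k U) (tape k v (exec v c s), lpos 0)
      \<and> valid L (exec v c s) \<and> length (snd (exec v c s)) \<le> length (snd s) + C"
    and h: "1 < h" "h < k" "h \<notin> writes c"
    and s: "valid L s" "L + length (snd s) + L * C \<le> U"
  defines "S j \<equiv> fold (\<lambda>j s. exec v c (setv h j s)) [0..<j] s"
  shows "runs (tr k (Loop h c)) (tape k v s, lpos 0) ((2 + L * (C + 2)) * op_time k U)
      (tape k v (setv h L (S L)), lpos 0)"
    and "valid L (S L)" and "length (snd (S L)) \<le> length (snd s) + L * C"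
proof -
  let ?X = "unit_time k U"
  let ?P = "\<lambda>a. a \<noteq> Blank"
  let ?body = "return_home k k ;; tr k c ;; inc_micro k h ;; goto_mark k h k"
  have LU: "L \<le> U" using s by simp
  have S_Suc: "S (Suc j) = exec v c (setv h j (S j))" for j
    by (simp add: S_def)
  have inv: "valid L (S j) \<and> length (snd (S j)) \<le> length (snd s) + j * C" if "j \<le> L" for j
    using that
  proof (induction j)
    case 0
    then show ?case using s by (simp add: S_def)
  next
    case (Suc j)
    have "L + length (snd (S j)) + C \<le> U"
    proof -
      have "Suc j * C \<le> L * C" using Suc.prems by (rule mult_le_mono1)
      then show ?thesis using Suc s by auto
    qed
    moreover have "valid L (setv h j (S j))"
      by (rule valid_setv) (use Suc h in auto)
    ultimately show ?case
      unfolding S_Suc using body[of "setv h j (S j)"] Suc by auto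
  qed
  show "valid L (S L)" "length (snd (S L)) \<le> length (snd s) + L * C"
    using inv by auto
  have room: "L + length (snd (S j)) + C \<le> U" if "j < L" for j
  proof -
    have "Suc j * C \<le> L * C" using that by (intro mult_le_mono1) simp
    then show ?thesis using inv[of j] that s by auto
  qed
  define I where "I j = setv h j (S j)" for j
  have valid_I: "valid L (I j)" if "j \<le> L" for j
    using that inv h by (auto simp: I_def intro: valid_setv)
  have I_h: "fst (I j) h = j" for j by (simp add: I_def)
  have data: "tape k v (I j) (lpos (j * k + k)) = (if j < L then sym_of_bool (v ! j) else Blank)" for j
    using work_data[of k v "fst (I j)" "Suc j"] h by (auto simp: tape_def L_def add.commute)
  have goto: "runs (goto_mark k h k) (tape k v (I j), lpos 0) (4 * ?X) (tape k v (I j), lpos (j * k + k))"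
    if "j \<le> L" for j
    using runs_goto[of h k k "fst (I j)" U "4 * ?X" v "snd (I j)"] h that LU
    by (simp add: tape_def I_h)
  have ret: "runs (return_home k k) (tape k v (I j), lpos (j * k + k)) (2 * ?X) (tape k v (I j), lpos 0)"
    if "j \<le> L" for j
    using runs_return[of k k j v U "2 * ?X" "fst (I j)" "snd (I j)"] h that LU
    by (simp add: tape_def L_def)
  have iter: "runs ?body (tape k v (I j), lpos (j * k + k)) ((C + 1) * op_time k U + 6 * ?X)
      (tape k v (I (Suc j)), lpos (Suc j * k + k))" if "j < L" for j
  proof -
    have r: "runs (tr k c) (tape k v (I j), lpos 0) (C * op_time k U) (tape k v (S (Suc j)), lpos 0)"
      using body[OF valid_I[of j]] room[OF that] that by (simp add: S_Suc I_def)
    have "fst (S (Suc j)) h = j"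
      using exec_not_written[OF h(3), of v "I j"] by (simp add: S_Suc I_def)
    then have i: "runs (inc_micro k h) (tape k v (S (Suc j)), lpos 0) (op_time k U) (tape k v (I (Suc j)), lpos 0)"
      using runs_inc_micro[of h k "fst (S (Suc j))" v U "snd (S (Suc j))"] h that LU
      by (simp add: tape_def I_def L_def min_absorb1 Suc_leI)
    have "runs ?body (tape k v (I j), lpos (j * k + k)) (2 * ?X + (C * op_time k U + (op_time k U + 4 * ?X)))
      (tape k v (I (Suc j)), lpos (Suc j * k + k))"
      using that by (intro runs_seq[OF ret runs_seq[OF r runs_seq[OF i goto order.refl] order.refl] order.refl]) auto
    then show ?thesis by (rule runs_mono) simp
  qed
  \<comment> \<open>Backward induction on \<open>j\<close>: the claim covers the rest of the loop
    from iteration \<open>j\<close> on, so each step prepends one iteration.\<close>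
  have loop: "runs (WhileS ?P ?body) (tape k v (I j), lpos (j * k + k)) (1 + (L - j) * ((C + 2) * op_time k U))
      (tape k v (I L), lpos (L * k + k))" if "j \<le> L" for j
    using that
  proof (induction rule: inc_induct)
    case base
    show ?case by (rule runs_while_false) (auto simp: data)
  next
    case (step j)
    have "L - j = Suc (L - Suc j)" using step by simp
    then have "Suc ((C + 1) * op_time k U + 6 * ?X + (1 + (L - Suc j) * ((C + 2) * op_time k U)))
        \<le> 1 + (L - j) * ((C + 2) * op_time k U)"
      using unit_time_ge(3)[of k U] by (simp add: op_time_def)
    then show ?case
      by (rule runs_while_true[OF _ iter[OF step.hyps(2)] step.IH, rotated]) (simp add: data step.hyps)
  qed
  have init: "runs (copy_micro k h 1) (tape k v s, lpos 0) (op_time k U) (tape k v (I 0), lpos 0)"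
    using runs_copy_micro[of h k 1 "fst s" v U "snd s"] h s
    by (simp add: tape_def I_def S_def valid_def L_def)
  have loop0: "runs (WhileS ?P ?body) (tape k v (I 0), lpos (0 * k + k)) (1 + L * ((C + 2) * op_time k U))
      (tape k v (I L), lpos (L * k + k))"
    using loop[of 0] by simp
  have "runs (tr k (Loop h c)) (tape k v s, lpos 0)
      (op_time k U + (4 * ?X + ((1 + L * ((C + 2) * op_time k U)) + 2 * ?X))) (tape k v (I L), lpos 0)"
    unfolding tr.simps
    using goto[of 0] ret[of L]
    by (intro runs_seq[OF init runs_seq[OF _ runs_seq[OF loop0 _ order.refl] order.refl] order.refl]) auto
  then show "runs (tr k (Loop h c)) (tape k v s, lpos 0) ((2 + L * (C + 2)) * op_time k U)
      (tape k v (setv h L (S L)), lpos 0)"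
    unfolding I_def
    by (rule runs_mono) (use unit_time_ge(3)[of k U] in \<open>simp add: op_time_def algebra_simps\<close>)
qed

text \<open>The number \<open>U\<close> is fixed in advance and leaves room for all output still to
  come. So a single bound \<open>op_time k U\<close> serves every operation, although appending a
  bit gets slower as the output grows.\<close>

theorem runs_tr:
  assumes "wfc k c" "valid (length v) s" "length v + length (snd s) + cost c (length v) \<le> U"
  shows "runs (tr k c) (tape k v s, lpos 0) (cost c (length v) * op_time k U) (tape k v (exec v c s), lpos 0)
      \<and> valid (length v) (exec v c s)
      \<and> length (snd (exec v c s)) \<le> length (snd s) + cost c (length v)"
  using assms
proof (induction c arbitrary: s)
  case Skip
  have "runs (mvn MoveL 0) (tape k v s, lpos 0) (op_time k U) (tape k v s, lpos 0)"
    by (rule runs_left) (simp_all add: op_time_def unit_time_def)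
  with Skip show ?case by simp
next
  case (Copy a b)
  then show ?case
    using runs_copy_micro[of a k b "fst s" v U "snd s"]
    by (auto simp: tape_def valid_def)
next
  case (Inc a)
  then show ?case
    using runs_inc_micro[of a k "fst s" v U "snd s"]
    by (auto simp: tape_def valid_def)
next
  case (Out b)
  then show ?case
    using runs_out_micro[of "work k v (fst s)" "snd s" U b k]
    by (auto simp: tape_def valid_def)
next
  case (Semi c d)
  let ?s = "exec v c s"
  have c: "runs (tr k c) (tape k v s, lpos 0) (cost c (length v) * op_time k U) (tape k v ?s, lpos 0)
      \<and> valid (length v) ?s \<and> length (snd ?s) \<le> length (snd s) + cost c (length v)"
    by (rule Semi.IH(1)) (use Semi.prems in auto)
  have d: "runs (tr k d) (tape k v ?s, lpos 0) (cost d (length v) * op_time k U) (tape k v (exec v d ?s), lpos 0)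
      \<and> valid (length v) (exec v d ?s) \<and> length (snd (exec v d ?s)) \<le> length (snd ?s) + cost d (length v)"
    by (rule Semi.IH(2)) (use Semi.prems c in auto)
  show ?case
    using c d by (auto intro!: runs_seq simp: algebra_simps)
next
  case (IfEq a b c d)
  let ?L = "length v" and ?X = "unit_time k U" and ?T = "tape k v s"
  have a: "0 < a" "a < k" "fst s a \<le> ?L" and b: "0 < b" "b < k" and U: "?L \<le> U"
    using IfEq.prems by (auto simp: valid_def)
  have goto: "runs (goto_mark k a b) (?T, lpos 0) (4 * ?X) (?T, lpos (fst s a * k + b))"
    unfolding tape_def by (rule runs_goto[where U = U]) (use a b U in auto)
  have ret: "runs (return_home k b) (?T, lpos (fst s a * k + b)) (2 * ?X) (?T, lpos 0)"
    unfolding tape_def by (rule runs_return[where U = U]) (use a b U in auto)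
  have sym: "?T (lpos (fst s a * k + b)) = One \<longleftrightarrow> fst s a = fst s b"
    using b by (auto simp: tape_def work_mark)
  have cd: "runs (tr k c) (?T, lpos 0) (cost c ?L * op_time k U) (tape k v (exec v c s), lpos 0)
      \<and> valid ?L (exec v c s) \<and> length (snd (exec v c s)) \<le> length (snd s) + cost c ?L"
    "runs (tr k d) (?T, lpos 0) (cost d ?L * op_time k U) (tape k v (exec v d s), lpos 0)
      \<and> valid ?L (exec v d s) \<and> length (snd (exec v d s)) \<le> length (snd s) + cost d ?L"
    by (rule IfEq.IH; use IfEq.prems in auto)+
  have "runs (tr k (IfEq a b c d)) (?T, lpos 0)
      (4 * ?X + Suc (2 * ?X + (cost c ?L + cost d ?L) * op_time k U)) (tape k v (exec v (IfEq a b c d) s), lpos 0)"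
  proof (cases "fst s a = fst s b")
    case True
    then show ?thesis
      unfolding tr.simps exec.simps using cd(1) sym
      by (auto intro!: runs_seq[OF goto] runs_if_true runs_seq[OF ret] simp: algebra_simps)
  next
    case False
    then show ?thesis
      unfolding tr.simps exec.simps using cd(2) sym
      by (auto intro!: runs_seq[OF goto] runs_if_false runs_seq[OF ret] simp: algebra_simps)
  qed
  then have "runs (tr k (IfEq a b c d)) (?T, lpos 0) (cost (IfEq a b c d) ?L * op_time k U)
      (tape k v (exec v (IfEq a b c d) s), lpos 0)"
    by (rule runs_mono) (use unit_time_ge(3)[of k U] in \<open>simp add: op_time_def algebra_simps\<close>)
  then show ?case using cd by auto
next
  case (IfBit a b c d)
  let ?L = "length v" and ?X = "unit_time k U" and ?T = "tape k v s"
  let ?P = "\<lambda>y. y = sym_of_bool b"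
  have a: "0 < a" "a < k" "fst s a \<le> ?L" and U: "?L \<le> U"
    using IfBit.prems by (auto simp: valid_def)
  have goto: "runs (goto_mark k a k) (?T, lpos 0) (4 * ?X) (?T, lpos (fst s a * k + k))"
    unfolding tape_def by (rule runs_goto[where U = U]) (use a U in auto)
  have ret: "runs (return_home k k) (?T, lpos (fst s a * k + k)) (2 * ?X) (?T, lpos 0)"
    unfolding tape_def by (rule runs_return[where U = U]) (use a U in auto)
  have sym: "?T (lpos (fst s a * k + k)) = sym_of_bool b \<longleftrightarrow> fst s a < ?L \<and> v ! fst s a = b"
    using a work_data[of k v "fst s" "Suc (fst s a)"] by (auto simp: tape_def add.commute)
  have cd: "runs (tr k c) (?T, lpos 0) (cost c ?L * op_time k U) (tape k v (exec v c s), lpos 0)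
      \<and> valid ?L (exec v c s) \<and> length (snd (exec v c s)) \<le> length (snd s) + cost c ?L"
    "runs (tr k d) (?T, lpos 0) (cost d ?L * op_time k U) (tape k v (exec v d s), lpos 0)
      \<and> valid ?L (exec v d s) \<and> length (snd (exec v d s)) \<le> length (snd s) + cost d ?L"
    by (rule IfBit.IH; use IfBit.prems in auto)+
  have "runs (tr k (IfBit a b c d)) (?T, lpos 0)
      (4 * ?X + Suc (2 * ?X + (cost c ?L + cost d ?L) * op_time k U)) (tape k v (exec v (IfBit a b c d) s), lpos 0)"
  proof (cases "fst s a < ?L \<and> v ! fst s a = b")
    case True
    then show ?thesis
      unfolding tr.simps exec.simps using cd(1) sym
      by (auto intro!: runs_seq[OF goto] runs_if_true runs_seq[OF ret] simp: algebra_simps)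
  next
    case False
    have "runs (IfS ?P (return_home k k ;; tr k c) (return_home k k ;; tr k d))
        (?T, lpos (fst s a * k + k)) (Suc (2 * ?X + cost d ?L * op_time k U)) (tape k v (exec v d s), lpos 0)"
      by (rule runs_if_false[where P = ?P]) (use False sym cd(2) in \<open>auto intro: runs_seq[OF ret]\<close>)
    then show ?thesis
      unfolding tr.simps exec.simps if_not_P[OF False]
      by (rule runs_seq[OF goto]) simp
  qed
  then have "runs (tr k (IfBit a b c d)) (?T, lpos 0) (cost (IfBit a b c d) ?L * op_time k U)
      (tape k v (exec v (IfBit a b c d) s), lpos 0)"
    by (rule runs_mono) (use unit_time_ge(3)[of k U] in \<open>simp add: op_time_def algebra_simps\<close>)
  then show ?case using cd by auto
next
  case (Loop h c)
  let ?L = "length v" and ?C = "cost c (length v)"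
  have body: "runs (tr k c) (tape k v s, lpos 0) (?C * op_time k U) (tape k v (exec v c s), lpos 0)
      \<and> valid ?L (exec v c s) \<and> length (snd (exec v c s)) \<le> length (snd s) + ?C"
    if "valid ?L s" "?L + length (snd s) + ?C \<le> U" for s
    using Loop.IH Loop.prems that by auto
  have h: "1 < h" "h < k" "h \<notin> writes c" and U: "?L + length (snd s) + ?L * ?C \<le> U"
    using Loop.prems by (auto simp: algebra_simps)
  note loop = runs_loop[OF body h Loop.prems(2) U]
  have "valid ?L (exec v (Loop h c) s)"
    unfolding exec.simps by (rule valid_setv[OF loop(2) order.refl h(1)])
  then show ?case
    using loop(1,3) unfolding exec.simps cost.simps setv_simps(2) by (auto simp: algebra_simps simp del: tr.simps)
qed

section \<open>Polynomial bounds\<close>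

definition poly_bounded :: "(nat \<Rightarrow> nat) \<Rightarrow> bool" where
  "poly_bounded f \<longleftrightarrow> (\<exists>A d. \<forall>L. f L \<le> A * (L + 1) ^ d)"

lemma poly_bounded_const: "poly_bounded (\<lambda>_. a)"
  unfolding poly_bounded_def by (rule exI[of _ a], rule exI[of _ 0]) simp

lemma poly_bounded_id: "poly_bounded (\<lambda>L. L)"
  unfolding poly_bounded_def by (rule exI[of _ 1], rule exI[of _ 1]) simp

lemma poly_bounded_add:
  assumes "poly_bounded f" "poly_bounded g"
  shows "poly_bounded (\<lambda>L. f L + g L)"
proof -
  from assms obtain A d A' d' where *: "\<And>L. f L \<le> A * (L + 1) ^ d" "\<And>L. g L \<le> A' * (L + 1) ^ d'"
    unfolding poly_bounded_def by blast
  have "f L + g L \<le> (A + A') * (L + 1) ^ (d + d')" for L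
  proof -
    have "(L + 1) ^ d \<le> (L + 1) ^ (d + d')" "(L + 1) ^ d' \<le> (L + 1) ^ (d + d')"
      by (rule power_increasing; simp)+
    then have "A * (L + 1) ^ d \<le> A * (L + 1) ^ (d + d')" "A' * (L + 1) ^ d' \<le> A' * (L + 1) ^ (d + d')"
      by (auto intro: mult_le_mono2)
    with *[of L] show ?thesis unfolding add_mult_distrib by linarith
  qed
  then show ?thesis unfolding poly_bounded_def by blast
qed

lemma poly_bounded_mult:
  assumes "poly_bounded f" "poly_bounded g"
  shows "poly_bounded (\<lambda>L. f L * g L)"
proof -
  from assms obtain A d A' d' where *: "\<And>L. f L \<le> A * (L + 1) ^ d" "\<And>L. g L \<le> A' * (L + 1) ^ d'"
    unfolding poly_bounded_def by blast
  have "f L * g L \<le> (A * A') * (L + 1) ^ (d + d')" for L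
    using mult_le_mono[OF *(1)[of L] *(2)[of L]] by (simp add: power_add mult_ac)
  then show ?thesis unfolding poly_bounded_def by blast
qed

lemma poly_bounded_power: "poly_bounded f \<Longrightarrow> poly_bounded (\<lambda>L. f L ^ e)"
  by (induction e) (auto intro: poly_bounded_const poly_bounded_mult)

lemmas poly_bounded_intros =
  poly_bounded_const poly_bounded_id poly_bounded_add poly_bounded_mult poly_bounded_power

lemma poly_bounded_cost: "poly_bounded (cost c)"
  by (induction c) (simp_all only: cost.simps[abs_def], (intro poly_bounded_intros; assumption?)+)

section \<open>Loading the input and clearing the work area\<close>

definition data_cells :: "nat \<Rightarrow> bool list \<Rightarrow> nat \<Rightarrow> sym" where
  "data_cells k v m =
    (if m mod k = 0 \<and> 0 < m div k \<and> m div k \<le> length v then sym_of_bool (v ! (m div k - 1)) else Blank)"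

lemma data_cells_mult: "0 < k \<Longrightarrow> data_cells k v (j * k) =
    (if 0 < j \<and> j \<le> length v then sym_of_bool (v ! (j - 1)) else Blank)"
  by (simp add: data_cells_def)

lemma data_cells_0 [simp]: "data_cells k v 0 = Blank"
  by (simp add: data_cells_def)

lemma data_cells_snoc:
  assumes "0 < k"
  shows "data_cells k (v @ [b]) = (data_cells k v)(Suc (length v) * k := sym_of_bool b)"
proof
  fix m
  have "m = Suc (length v) * k \<longleftrightarrow> m mod k = 0 \<and> m div k = Suc (length v)"
    using assms by (metis add_0 mod_mult_self2_is_0 mult_div_mod_eq mult.commute add.right_neutral
        nonzero_mult_div_cancel_right not_less_zero)
  then show "data_cells k (v @ [b]) m = ((data_cells k v)(Suc (length v) * k := sym_of_bool b)) m"
    by (auto simp: data_cells_def nth_append simp del: mult_Suc)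
qed

lemma layout_pos: "layout W out (int i) = (if i < length out then sym_of_bool (out ! i) else Blank)"
  by (simp add: layout_def)

lemma layout_minus1: "layout W out (-1) = W 0"
  using layout_lpos[of W out 0] by (simp add: lpos_def)

lemma runs_to_end:
  assumes "Suc (length out * 3) \<le> C"
  shows "runs (WhileS (\<lambda>a. a \<noteq> Blank) (mvn MoveR 1)) (layout W out, 0) C (layout W out, int (length out))"
proof -
  have "runs (WhileS (\<lambda>a. a \<noteq> Blank) (mvn MoveR 1)) (layout W out, 0) (Suc (length out * (1 + 2)))
     (layout W out, int (length out))"
    using runs_walk[of "length out" "\<lambda>a. a \<noteq> Blank" "layout W out" 0 1 MoveR]
    by (simp add: move_def layout_pos)
  then show ?thesis by (rule runs_mono) (use assms in simp)
qed

lemma runs_to_separator: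
  assumes "W 0 = Blank" "Suc (length out * 3) \<le> C"
  shows "runs (WhileS (\<lambda>a. a \<noteq> Blank) (mvn MoveL 1)) (layout W out, int (length out) - 1) C
    (layout W out, lpos 0)"
proof -
  have "layout W out (int (length out) - 1 - int i) \<noteq> Blank" if "i < length out" for i
  proof -
    have "int (length out) - 1 - int i = int (length out - Suc i)" using that by simp
    then show ?thesis using that by (simp only: layout_pos) simp
  qed
  then have "runs (WhileS (\<lambda>a. a \<noteq> Blank) (mvn MoveL 1)) (layout W out, int (length out) - 1)
      (Suc (length out * (1 + 2))) (layout W out, lpos 0)"
    using runs_walk[of "length out" "\<lambda>a. a \<noteq> Blank" "layout W out" "int (length out) - 1" 1 MoveL]
      layout_minus1[of W out] assms(1)
    by (simp add: move_def lpos_def)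
  then show ?thesis by (rule runs_mono) (use assms in simp)
qed

text \<open>The carried bit is kept in the control: there is one copy of the program for each value.
  Input bits are never blank, so the separator is found as the first blank to their left.\<close>

definition carry :: "nat \<Rightarrow> bool \<Rightarrow> micro" where
  "carry k b = wr Blank ;; mvn MoveL 1 ;; WhileS (\<lambda>a. a \<noteq> Blank) (mvn MoveL 1) ;;
     mvn MoveL k ;; WhileS (\<lambda>a. a \<noteq> Blank) (mvn MoveL k) ;; wr (sym_of_bool b) ;;
     return_home k k ;; mvn MoveR 1 ;; WhileS (\<lambda>a. a \<noteq> Blank) (mvn MoveR 1) ;; mvn MoveL 1"

text \<open>The input is carried bit by bit from its right end to the left end of the work area.
  This reverses it, but frees the output area from position 0 on.\<close>

definition load :: "nat \<Rightarrow> micro" where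
  "load k = WhileS (\<lambda>a. a \<noteq> Blank) (mvn MoveR 1) ;; mvn MoveL 1 ;;
     WhileS (\<lambda>a. a \<noteq> Blank) (IfS (\<lambda>a. a = One) (carry k True) (carry k False))"

lemma runs_goto_data_end:
  assumes "\<And>j. 0 < j \<Longrightarrow> j \<le> n \<Longrightarrow> W (j * k) \<noteq> Blank" "W (Suc n * k) = Blank" "n \<le> U"
    and "C = unit_time k U"
  shows "runs (mvn MoveL k) (layout W out, lpos 0) C (layout W out, lpos k)"
    and "runs (WhileS (\<lambda>a. a \<noteq> Blank) (mvn MoveL k)) (layout W out, lpos k) C
      (layout W out, lpos (Suc n * k))"
proof -
  show "runs (mvn MoveL k) (layout W out, lpos 0) C (layout W out, lpos k)"
    by (rule runs_left) (use assms(4) unit_time_ge in auto)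
  have "W (k + i * k) \<noteq> Blank" if "i < n" for i
    using assms(1)[of "Suc i"] that by simp
  then show "runs (WhileS (\<lambda>a. a \<noteq> Blank) (mvn MoveL k)) (layout W out, lpos k) C
      (layout W out, lpos (Suc n * k))"
    by (intro runs_walk_left[where j = n]) (use assms unit_time_ge in auto)
qed

lemma runs_carry:
  assumes "0 < k" "length v + length r + 1 \<le> U"
  shows "runs (carry k b) (layout (data_cells k v) (r @ [b]), int (length r)) (op_time k U)
    (layout (data_cells k (v @ [b])) r, int (length r) - 1)"
proof -
  let ?X = "unit_time k U" and ?n = "length v"
  let ?W = "data_cells k v" and ?W' = "data_cells k (v @ [b])"
  let ?P = "\<lambda>a. a \<noteq> Blank"
  have X: "2 * U + 4 \<le> ?X" "1 \<le> ?X"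
    using assms by (simp_all add: unit_time_def algebra_simps)
  have W': "layout ?W' r = layout (?W(Suc ?n * k := sym_of_bool b)) r"
    using assms by (simp only: data_cells_snoc)
  have 1: "runs (wr Blank) (layout ?W (r @ [b]), int (length r)) ?X (layout ?W r, int (length r))"
    unfolding wr_def by (rule runs_act) (use X in \<open>auto simp: layout_def move_def nth_append fun_eq_iff\<close>)
  have "runs (mvn MoveL 1) (layout ?W r, int (length r)) (Suc 1) (layout ?W r, int (length r) - 1)"
    using runs_mvn[of MoveL 1 "layout ?W r" "int (length r)"] by (simp add: move_def)
  then have 2: "runs (mvn MoveL 1) (layout ?W r, int (length r)) ?X (layout ?W r, int (length r) - 1)"
    by (rule runs_mono) (use X in simp)
  have 3: "runs (WhileS ?P (mvn MoveL 1)) (layout ?W r, int (length r) - 1) (2 * ?X) (layout ?W r, lpos 0)"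
    by (rule runs_to_separator) (use X assms in auto)
  have 4: "runs (mvn MoveL k) (layout ?W r, lpos 0) ?X (layout ?W r, lpos k)"
      "runs (WhileS ?P (mvn MoveL k)) (layout ?W r, lpos k) ?X (layout ?W r, lpos (Suc ?n * k))"
    by (rule runs_goto_data_end[where n = ?n and U = U];
        use assms in \<open>auto simp: data_cells_mult simp del: mult_Suc\<close>)+
  have 5: "runs (wr (sym_of_bool b)) (layout ?W r, lpos (Suc ?n * k)) ?X (layout ?W' r, lpos (Suc ?n * k))"
    unfolding W' by (rule runs_wr) (use X in simp)
  have 6: "runs (return_home k k) (layout ?W' r, lpos (Suc ?n * k)) (2 * ?X) (layout ?W' r, lpos 0)"
    by (rule runs_return_home[where j = ?n and U = U]) (use assms in \<open>auto simp: data_cells_mult\<close>)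
  have "runs (mvn MoveR 1) (layout ?W' r, lpos 0) (Suc 1) (layout ?W' r, 0)"
    using runs_mvn[of MoveR 1 "layout ?W' r" "lpos 0"] by (simp add: move_def lpos_def)
  then have 7: "runs (mvn MoveR 1) (layout ?W' r, lpos 0) ?X (layout ?W' r, 0)"
    by (rule runs_mono) (use X in simp)
  have 8: "runs (WhileS ?P (mvn MoveR 1)) (layout ?W' r, 0) (2 * ?X) (layout ?W' r, int (length r))"
    by (rule runs_to_end) (use X assms in auto)
  have "runs (mvn MoveL 1) (layout ?W' r, int (length r)) (Suc 1) (layout ?W' r, int (length r) - 1)"
    using runs_mvn[of MoveL 1 "layout ?W' r" "int (length r)"] by (simp add: move_def)
  then have 9: "runs (mvn MoveL 1) (layout ?W' r, int (length r)) ?X (layout ?W' r, int (length r) - 1)"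
    by (rule runs_mono) (use X in simp)
  have "runs (carry k b) (layout ?W (r @ [b]), int (length r))
      (?X + (?X + (2 * ?X + (?X + (?X + (?X + (2 * ?X + (?X + (2 * ?X + ?X)))))))))
      (layout ?W' r, int (length r) - 1)"
    unfolding carry_def
    by (intro runs_seqI[OF 1] runs_seqI[OF 2] runs_seqI[OF 3] runs_seqI[OF 4(1)] runs_seqI[OF 4(2)]
        runs_seqI[OF 5] runs_seqI[OF 6] runs_seqI[OF 7] runs_seqI[OF 8] 9)
  then show ?thesis by (rule runs_mono) (simp add: op_time_def)
qed

lemma runs_load:
  assumes "0 < k" "length w \<le> U"
  shows "runs (load k) (layout (\<lambda>_. Blank) w, 0) ((length w + 1) * (2 * op_time k U))
    (layout (data_cells k (rev w)) [], lpos 0)"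
proof -
  let ?X = "unit_time k U"
  let ?P = "\<lambda>a. a \<noteq> Blank" and ?Q = "\<lambda>a. a = One"
  let ?body = "IfS ?Q (carry k True) (carry k False)"
  have X: "2 * U + 4 \<le> ?X"
    using assms by (simp add: unit_time_def algebra_simps)
  have loop: "runs (WhileS ?P ?body) (layout (data_cells k v) r, int (length r) - 1)
      (1 + length r * (2 * op_time k U)) (layout (data_cells k (v @ rev r)) [], lpos 0)"
    if "length v + length r \<le> U" for v r
    using that
  proof (induction r arbitrary: v rule: rev_induct)
    case Nil
    \<comment> \<open>When the input is used up, the head stands at -1, which is the separator; its
      blank ends the loop in the right place.\<close>
    show ?case
      by (simp add: lpos_def) (rule runs_while_false; simp add: layout_minus1)
  next
    case (snoc b r)
    let ?s = "(layout (data_cells k v) (r @ [b]), int (length r))"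
    have sym: "layout (data_cells k v) (r @ [b]) (int (length r)) = sym_of_bool b"
      by (simp add: layout_pos)
    have carry: "runs (carry k b) ?s (op_time k U) (layout (data_cells k (v @ [b])) r, int (length r) - 1)"
      by (rule runs_carry) (use snoc.prems assms in auto)
    have body: "runs ?body ?s (Suc (op_time k U)) (layout (data_cells k (v @ [b])) r, int (length r) - 1)"
    proof (cases b)
      case True
      then show ?thesis
        using carry sym by (intro runs_if_true[where P = ?Q]) (auto simp: sym_of_bool_def)
    next
      case False
      then show ?thesis
        using carry sym by (intro runs_if_false[where P = ?Q]) (auto simp: sym_of_bool_def)
    qed
    have IH: "runs (WhileS ?P ?body) (layout (data_cells k (v @ [b])) r, int (length r) - 1)
        (1 + length r * (2 * op_time k U)) (layout (data_cells k ((v @ [b]) @ rev r)) [], lpos 0)"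
      by (rule snoc.IH) (use snoc.prems in simp)
    have "3 \<le> op_time k U" using X by (simp add: op_time_def)
    then have "runs (WhileS ?P ?body) ?s (1 + length (r @ [b]) * (2 * op_time k U))
        (layout (data_cells k ((v @ [b]) @ rev r)) [], lpos 0)"
      by (intro runs_while_true[where P = ?P, OF _ body IH]) (use sym in auto)
    then show ?case by simp
  qed
  have blank: "(\<lambda>_. Blank) = data_cells k []"
    by (auto simp: data_cells_def)
  have 1: "runs (WhileS ?P (mvn MoveR 1)) (layout (data_cells k []) w, 0) (2 * ?X)
      (layout (data_cells k []) w, int (length w))"
    by (rule runs_to_end) (use X assms in simp)
  have 2: "runs (mvn MoveL 1) (layout (data_cells k []) w, int (length w)) (Suc 1)
      (layout (data_cells k []) w, int (length w) - 1)"
    using runs_mvn[of MoveL 1 "layout (data_cells k []) w" "int (length w)"] by (simp add: move_def)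
  have 3: "runs (WhileS ?P ?body) (layout (data_cells k []) w, int (length w) - 1)
      (1 + length w * (2 * op_time k U)) (layout (data_cells k (rev w)) [], lpos 0)"
    using loop[of "[]" w] assms by simp
  have "runs (load k) (layout (data_cells k []) w, 0) (2 * ?X + (Suc 1 + (1 + length w * (2 * op_time k U))))
      (layout (data_cells k (rev w)) [], lpos 0)"
    unfolding load_def by (intro runs_seqI[OF 1] runs_seqI[OF 2] 3)
  then show ?thesis
    unfolding blank by (rule runs_mono) (use X in \<open>simp add: op_time_def\<close>)
qed

primrec mark_cells :: "nat \<Rightarrow> micro" where
  "mark_cells 0 = mvn MoveL 0"
| "mark_cells (Suc n) = mvn MoveL 1 ;; wr One ;; mark_cells n"

lemma runs_mark_cells:
  "runs (mark_cells n) (layout W out, lpos m) (3 * n + 1)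
     (layout (\<lambda>i. if m < i \<and> i \<le> m + n then One else W i) out, lpos (m + n))"
proof (induction n arbitrary: m W)
  case 0
  have "(\<lambda>i. if m < i \<and> i \<le> m + 0 then One else W i) = W" by (intro ext) auto
  then show ?case unfolding mark_cells.simps by (simp only:) (rule runs_left; simp)
next
  case (Suc n)
  have 1: "runs (mvn MoveL 1) (layout W out, lpos m) 2 (layout W out, lpos (Suc m))"
    by (rule runs_left) auto
  have 2: "runs (wr One) (layout W out, lpos (Suc m)) 1 (layout (W(Suc m := One)) out, lpos (Suc m))"
    by (rule runs_wr) simp
  have eq: "(\<lambda>i. if Suc m < i \<and> i \<le> Suc m + n then One else (W(Suc m := One)) i)
      = (\<lambda>i. if m < i \<and> i \<le> m + Suc n then One else W i)"
    by (auto simp: fun_eq_iff)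
  show ?case
    unfolding mark_cells.simps add_Suc_shift[symmetric]
    using runs_seq[OF 1 runs_seqI[OF 2 Suc.IH[where m = "Suc m"], unfolded eq], of "3 * Suc n + 1"] by simp
qed

definition init_marks :: "nat \<Rightarrow> micro" where
  "init_marks k = mark_cells (k - 1) ;; mvn MoveR (k - 1)"

lemma runs_init_marks:
  assumes "0 < k"
  shows "runs (init_marks k) (layout (data_cells k v) out, lpos 0) (op_time k U)
    (layout (work k v (\<lambda>_. 0)) out, lpos 0)"
proof -
  have eq: "(\<lambda>i. if 0 < i \<and> i \<le> 0 + (k - 1) then One else data_cells k v i) = work k v (\<lambda>_. 0)"
  proof
    fix i
    show "(if 0 < i \<and> i \<le> 0 + (k - 1) then One else data_cells k v i) = work k v (\<lambda>_. 0) i"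
    proof (cases "i < k")
      case True
      then show ?thesis using assms by (auto simp: data_cells_def work_def)
    next
      case False
      then have "i div k \<noteq> 0" using assms by (simp add: div_eq_0_iff)
      then show ?thesis using assms False by (auto simp: data_cells_def work_def)
    qed
  qed
  have 1: "runs (mark_cells (k - 1)) (layout (data_cells k v) out, lpos 0) (3 * (k - 1) + 1)
      (layout (work k v (\<lambda>_. 0)) out, lpos (0 + (k - 1)))"
    using runs_mark_cells[of "k - 1" "data_cells k v" out 0] unfolding eq .
  have 2: "runs (mvn MoveR (k - 1)) (layout (work k v (\<lambda>_. 0)) out, lpos (0 + (k - 1))) (Suc (k - 1))
      (layout (work k v (\<lambda>_. 0)) out, lpos 0)"
    by (rule runs_right) auto
  show ?thesis
    unfolding init_marks_def
    by (rule runs_seq[OF 1 2]) (use assms in \<open>simp add: op_time_def unit_time_def algebra_simps\<close>)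
qed

section \<open>Erasing the work area\<close>

primrec erase :: "nat \<Rightarrow> micro" where
  "erase 0 = mvn MoveL 0"
| "erase (Suc n) = wr Blank ;; mvn MoveR 1 ;; erase n"

definition trunc :: "(nat \<Rightarrow> sym) \<Rightarrow> nat \<Rightarrow> nat \<Rightarrow> sym" where
  "trunc W b = (\<lambda>m. if m \<le> b then W m else Blank)"

lemma runs_erase:
  "runs (erase n) (layout (trunc W (b + n)) out, lpos (b + n)) (3 * n + 1) (layout (trunc W b) out, lpos b)"
proof (induction n)
  case 0
  show ?case by (simp only: erase.simps add_0_right) (rule runs_left; simp)
next
  case (Suc n)
  have eq: "(trunc W (Suc (b + n)))(Suc (b + n) := Blank) = trunc W (b + n)"
    by (auto simp: trunc_def fun_eq_iff)
  have 1: "runs (wr Blank) (layout (trunc W (Suc (b + n))) out, lpos (Suc (b + n))) 1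
      (layout (trunc W (b + n)) out, lpos (Suc (b + n)))"
    unfolding eq[symmetric] by (rule runs_wr) simp
  have 2: "runs (mvn MoveR 1) (layout (trunc W (b + n)) out, lpos (Suc (b + n))) 2
      (layout (trunc W (b + n)) out, lpos (b + n))"
    by (rule runs_right) auto
  show ?case
    unfolding erase.simps add_Suc_right
    by (rule runs_seq[OF 1 runs_seq[OF 2 Suc.IH order.refl]]) simp
qed

text \<open>The first \<open>erase k\<close> is unconditional because block \<open>length v\<close>
  may carry marks although its data cell is blank; in the remaining blocks the data bit itself
  announces that there is something to erase.\<close>

definition cleanup :: "nat \<Rightarrow> micro" where
  "cleanup k = mvn MoveL k ;; WhileS (\<lambda>a. a \<noteq> Blank) (mvn MoveL k) ;; erase k ;;
     WhileS (\<lambda>a. a \<noteq> Blank) (erase k) ;; mvn MoveR 1"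

lemma runs_cleanup:
  assumes k: "0 < k" and p: "\<And>h. p h \<le> length v" and U: "length v \<le> U"
  shows "runs (cleanup k) (layout (work k v p) out, lpos 0) ((length v + 1) * op_time k U)
    (layout (\<lambda>_. Blank) out, 0)"
proof -
  let ?X = "unit_time k U" and ?n = "length v" and ?W = "work k v p"
  let ?P = "\<lambda>a. a \<noteq> Blank"
  have X: "4 * k + 4 \<le> 4 * ?X" "1 \<le> ?X"
    by (simp_all add: unit_time_def algebra_simps)
  \<comment> \<open>No variable exceeds \<open>length v\<close>, so nothing is written to the left
    of block \<open>length v\<close>.\<close>
  have tr: "trunc ?W (Suc ?n * k) = ?W"
  proof
    fix m
    have "?W m = Blank" if m: "Suc ?n * k < m"
    proof (cases "m mod k = 0")
      case True
      then have "m = m div k * k" by (metis add.right_neutral div_mult_mod_eq)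
      then have "Suc ?n < m div k" using m by (metis mult_less_cancel2)
      then show ?thesis using True by (simp add: work_def)
    next
      case False
      have "Suc ?n * k div k \<le> m div k" using m by (intro div_le_mono) simp
      then have "Suc ?n \<le> m div k" using k by (metis nonzero_mult_div_cancel_right not_less_zero)
      then have "p (m mod k) \<noteq> m div k" using p[of "m mod k"] by linarith
      then show ?thesis using False by (simp add: work_def)
    qed
    then show "trunc ?W (Suc ?n * k) m = ?W m" by (simp add: trunc_def)
  qed
  have 1: "runs (mvn MoveL k) (layout ?W out, lpos 0) ?X (layout ?W out, lpos k)"
      "runs (WhileS ?P (mvn MoveL k)) (layout ?W out, lpos k) ?X (layout ?W out, lpos (Suc ?n * k))"
    by (rule runs_goto_data_end[where n = ?n and U = U];
        use k U in \<open>auto simp: work_data simp del: mult_Suc\<close>)+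
  have erase: "runs (erase k) (layout (trunc ?W (Suc j * k)) out, lpos (Suc j * k)) (3 * k + 1)
      (layout (trunc ?W (j * k)) out, lpos (j * k))" for j
    using runs_erase[of k ?W "j * k" out] by (simp add: add.commute)
  have loop: "runs (WhileS ?P (erase k)) (layout (trunc ?W (j * k)) out, lpos (j * k)) (1 + j * (3 * k + 2))
      (layout (trunc ?W 0) out, lpos 0)" if "j \<le> ?n" for j
    using that
  proof (induction j)
    case 0
    show ?case by (simp only: mult_0) (rule runs_while_false; simp add: trunc_def)
  next
    case (Suc j)
    show ?case
      by (rule runs_while_true[OF _ erase Suc.IH])
        (use Suc.prems k in \<open>auto simp: trunc_def work_data simp del: mult_Suc\<close>, simp)
  qed
  have "trunc ?W 0 = (\<lambda>_. Blank)" by (auto simp: trunc_def)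
  note loop = loop[OF order.refl, unfolded this]
  have 2: "runs (mvn MoveR 1) (layout (\<lambda>_. Blank) out, lpos 0) 2 (layout (\<lambda>_. Blank) out, 0)"
    using runs_mvn[of MoveR 1 "layout (\<lambda>_. Blank) out" "lpos 0"] by (simp add: move_def lpos_def numeral_2_eq_2)
  have "runs (cleanup k) (layout ?W out, lpos 0)
      (?X + (?X + ((3 * k + 1) + ((1 + ?n * (3 * k + 2)) + 2)))) (layout (\<lambda>_. Blank) out, 0)"
    unfolding cleanup_def
    by (intro runs_seqI[OF 1(1)] runs_seqI[OF 1(2)] runs_seqI[OF erase[of ?n, unfolded tr]]
        runs_seqI[OF loop] 2)
  moreover have "?n * (3 * k + 2) \<le> ?n * (4 * ?X)"
    using X by (intro mult_le_mono2) linarith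
  then have "?X + (?X + ((3 * k + 1) + ((1 + ?n * (3 * k + 2)) + 2))) \<le> (?n + 1) * op_time k U"
    using X unfolding op_time_def by (simp add: algebra_simps)
  ultimately show ?thesis by (rule runs_mono)
qed

definition input_tape :: "bool list \<Rightarrow> int \<Rightarrow> sym" where
  "input_tape w = layout (\<lambda>_. Blank) w"

lemma init_conf_input_tape: "init_conf w = (0, input_tape w, 0)"
  by (auto simp: init_conf_def input_tape_def layout_def fun_eq_iff)

text \<open>One polynomial bounds both the time and the output length; the latter is needed because
  the delay of the enumerator is measured in the length of the graph encoding. The program sees
  \<open>rev w\<close> because loading reverses the input.\<close>

theorem com_computable:
  assumes "wfc k c" "0 < k"
  shows "\<exists>m B. poly_bounded B \<and>
    (\<forall>w. runs m (input_tape w, 0) (B (length w)) (input_tape (snd (exec (rev w) c (\<lambda>_. 0, []))), 0)) \<and>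
    (\<forall>w. length (snd (exec (rev w) c (\<lambda>_. 0, []))) \<le> B (length w))"
proof (intro exI conjI allI)
  define m where "m = load k ;; init_marks k ;; tr k c ;; cleanup k"
  define B where "B L = (let U = L + cost c L in
    (L + 1) * (2 * op_time k U) + (op_time k U + (cost c L * op_time k U + (L + 1) * op_time k U)))" for L
  show "poly_bounded B"
    unfolding B_def Let_def op_time_def unit_time_def
    by (intro poly_bounded_intros poly_bounded_cost)
  fix w :: "bool list"
  let ?v = "rev w" and ?L = "length w" and ?s = "(\<lambda>_. 0, []) :: cstate"
  let ?U = "?L + cost c ?L"
  let ?s' = "exec ?v c ?s"
  have tr: "runs (tr k c) (tape k ?v ?s, lpos 0) (cost c ?L * op_time k ?U) (tape k ?v ?s', lpos 0)
      \<and> valid ?L ?s' \<and> length (snd ?s') \<le> length (snd ?s) + cost c ?L"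
    using runs_tr[of k c ?v ?s ?U] assms by (auto simp: valid_def)
  have 1: "runs (load k) (input_tape w, 0) ((?L + 1) * (2 * op_time k ?U)) (layout (data_cells k ?v) [], lpos 0)"
    unfolding input_tape_def by (rule runs_load) (use assms in auto)
  have 2: "runs (init_marks k) (layout (data_cells k ?v) [], lpos 0) (op_time k ?U) (tape k ?v ?s, lpos 0)"
    unfolding tape_def fst_conv snd_conv by (rule runs_init_marks[OF assms(2)])
  have 3: "runs (cleanup k) (tape k ?v ?s', lpos 0) ((?L + 1) * op_time k ?U) (input_tape (snd ?s'), 0)"
    unfolding tape_def input_tape_def
    using runs_cleanup[OF assms(2), of "fst ?s'" ?v ?U] tr by (auto simp: valid_def)
  show "runs m (input_tape w, 0) (B ?L) (input_tape (snd ?s'), 0)"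
    unfolding m_def B_def Let_def
    by (intro runs_seqI[OF 1] runs_seqI[OF 2] runs_seqI[OF tr[THEN conjunct1]] 3)
  have "1 \<le> op_time k ?U" by (simp add: op_time_def unit_time_def)
  then have "cost c ?L * 1 \<le> cost c ?L * op_time k ?U" by (rule mult_le_mono2)
  then show "length (snd ?s') \<le> B ?L"
    using tr[THEN conjunct2, THEN conjunct2] unfolding B_def Let_def by (simp only: snd_conv list.size mult_1_right)
qed

section \<open>A program that prints the split graph\<close>

text \<open>Position \<open>h\<close> of the reversed input \<open>v\<close> contributes four vertices: \<open>4 * h\<close> and \<open>4 * h + 1\<close> in the
  clique, \<open>4 * h + 2\<close> and \<open>4 * h + 3\<close> in the independent set. Hypergraph vertex \<open>i < n\<close> is \<open>4 * i\<close>.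
  The vertex \<open>4 * h + 2\<close> is pendant and forces \<open>4 * h + 1\<close> if \<open>h < n\<close>, and \<open>4 * h\<close> otherwise.
  The reversed input consists of rows of length \<open>n + 1\<close>, all but the last of which encode a hyperedge;
  \<open>4 * h + 3\<close> stands for the hyperedge in the row that ends just before \<open>h\<close>,
  if there is one, and is a twin of \<open>4 * h + 2\<close> otherwise.\<close>

definition mixed_adj :: "bool list \<Rightarrow> nat \<Rightarrow> nat \<Rightarrow> nat \<Rightarrow> nat \<Rightarrow> nat \<Rightarrow> bool" where
  "mixed_adj v n t x t' y =
    (if t' = 3 \<and> Suc n dvd y \<and> y \<noteq> 0
     then t = 0 \<and> x < n \<and> (\<exists>d<length v. v ! d \<and> d + 2 + x = y)
     else x = y \<and> t = (if x < n then 1 else 0))"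

definition adj :: "bool list \<Rightarrow> nat \<Rightarrow> nat \<Rightarrow> nat \<Rightarrow> bool" where
  "adj v n u w =
    (if u mod 4 < 2 then (if w mod 4 < 2 then u \<noteq> w else mixed_adj v n (u mod 4) (u div 4) (w mod 4) (w div 4))
     else (if w mod 4 < 2 then mixed_adj v n (w mod 4) (w div 4) (u mod 4) (u div 4) else False))"

abbreviation (input) "vZ \<equiv> 1 :: nat"
abbreviation (input) "vN \<equiv> 2 :: nat"
abbreviation (input) "vH \<equiv> 3 :: nat"
abbreviation (input) "vI \<equiv> 4 :: nat"
abbreviation (input) "vG \<equiv> 5 :: nat"
abbreviation (input) "vT \<equiv> 6 :: nat"
abbreviation (input) "vS \<equiv> 7 :: nat"
abbreviation (input) "vD \<equiv> 8 :: nat"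
abbreviation (input) "vC \<equiv> 9 :: nat"
abbreviation (input) "r_ge \<equiv> 10 :: nat"
abbreviation (input) "r_edge \<equiv> 11 :: nat"
abbreviation (input) "r_mem \<equiv> 12 :: nat"

text \<open>The flag \<open>vC\<close> is raised when \<open>vG\<close> passes \<open>n\<close> and
  is sampled when \<open>vG\<close> equals \<open>x\<close>. Raising comes first, so
  \<open>x = n\<close> counts as at least \<open>n\<close>.\<close>

definition calc_ge :: "nat \<Rightarrow> com" where
  "calc_ge x = Semi (Copy r_ge vZ) (Semi (Copy vC vZ)
     (Loop vG (Semi (IfEq vG vN (Inc vC) Skip) (IfEq vG x (Copy r_ge vC) Skip))))"

text \<open>The counter \<open>vC\<close> holds \<open>vG\<close> modulo \<open>n + 1\<close>, which
  replaces a divisibility test.\<close>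

definition calc_edge :: "nat \<Rightarrow> com" where
  "calc_edge y = Semi (Copy r_edge vZ) (Semi (Copy vC vZ)
     (Loop vG (Semi (IfEq vG y (IfEq vC vZ (IfEq vG vZ Skip (Inc r_edge)) Skip) Skip)
        (IfEq vC vN (Copy vC vZ) (Inc vC)))))"

definition calc_sum :: "nat \<Rightarrow> com" where
  "calc_sum x = Semi (Copy vT vD) (Semi (Inc vT) (Semi (Inc vT) (Semi (Copy vS vZ)
     (Loop vG (IfEq vS x Skip (Semi (Inc vS) (Inc vT)))))))"

definition calc_mem :: "nat \<Rightarrow> nat \<Rightarrow> com" where
  "calc_mem x y = Semi (Copy r_mem vZ)
     (Loop vD (IfBit vD True (Semi (calc_sum x) (IfEq vT y (Inc r_mem) Skip)) Skip))"

definition emit_forced :: "nat \<Rightarrow> nat \<Rightarrow> nat \<Rightarrow> com" where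
  "emit_forced t x y = IfEq x y (IfEq r_ge vZ (Out (t = 1)) (Out (t = 0))) (Out False)"

definition emit_mixed :: "nat \<Rightarrow> nat \<Rightarrow> nat \<Rightarrow> nat \<Rightarrow> com" where
  "emit_mixed t x t' y = Semi (calc_ge x) (Semi (calc_edge y) (Semi (calc_mem x y)
     (if t' = 3
      then IfEq r_edge vZ (emit_forced t x y)
        (IfEq r_ge vZ (IfEq r_mem vZ (Out False) (Out (t = 0))) (Out False))
      else emit_forced t x y)))"

text \<open>The residues \<open>t\<close> and \<open>t'\<close> are parameters of the program text:
  only the quotients of the two vertices by 4 are run-time values, and these are input
  positions.\<close>

definition emit_cell :: "nat \<Rightarrow> nat \<Rightarrow> com" where
  "emit_cell t t' =
    (if t < 2 then (if t' < 2 then (if t = t' then IfEq vH vI (Out False) (Out True) else Out True)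
       else emit_mixed t vH t' vI)
     else (if t' < 2 then emit_mixed t' vI t vH else Out False))"

definition emit_row :: "nat \<Rightarrow> com" where
  "emit_row t = Loop vI (Semi (emit_cell t 0) (Semi (emit_cell t 1) (Semi (emit_cell t 2) (emit_cell t 3))))"

text \<open>In the reversed input the unary header comes last, so \<open>n\<close> is the length of
  the final run of ones; each zero resets the count.\<close>

definition calc_n :: com where
  "calc_n = Semi (Copy vN vZ) (Loop vG (IfBit vG True (Inc vN) (Copy vN vZ)))"

definition emit_graph :: com where
  "emit_graph = Semi calc_n
     (Semi (Loop vH (Semi (Out True) (Semi (Out True) (Semi (Out True) (Out True)))))
     (Semi (Out False)
       (Loop vH (Semi (emit_row 0) (Semi (emit_row 1) (Semi (emit_row 2) (emit_row 3)))))))"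

lemmas emit_graph_defs = emit_graph_def calc_n_def emit_row_def emit_cell_def emit_mixed_def
  emit_forced_def calc_mem_def calc_sum_def calc_edge_def calc_ge_def

lemma wfc_emit_graph: "wfc 13 emit_graph"
  by (simp add: emit_graph_defs)

section \<open>Correctness of the printing program\<close>

primrec silent :: "com \<Rightarrow> bool" where
  "silent Skip \<longleftrightarrow> True"
| "silent (Copy a b) \<longleftrightarrow> True"
| "silent (Inc a) \<longleftrightarrow> True"
| "silent (Out b) \<longleftrightarrow> False"
| "silent (Semi c d) \<longleftrightarrow> silent c \<and> silent d"
| "silent (IfEq a b c d) \<longleftrightarrow> silent c \<and> silent d"
| "silent (IfBit a b c d) \<longleftrightarrow> silent c \<and> silent d"
| "silent (Loop h c) \<longleftrightarrow> silent c"

lemma exec_silent: "silent c \<Longrightarrow> snd (exec v c s) = snd s"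
proof (induction c arbitrary: s)
  case (Loop h c)
  have "snd (fold (\<lambda>j s. exec v c (setv h j s)) js s) = snd s" for js s
    using Loop by (induction js arbitrary: s) auto
  then show ?case by simp
qed auto

lemma fold_upt_induct:
  assumes "I 0 s" and "\<And>j s. j < L \<Longrightarrow> I j s \<Longrightarrow> I (Suc j) (f j s)"
  shows "I L (fold f [0..<L] s)"
proof -
  have "I j (fold f [0..<j] s)" if "j \<le> L" for j
    using that by (induction j) (use assms in auto)
  then show ?thesis by simp
qed

lemma exec_Loop_induct:
  assumes "I 0 s" and "\<And>j s. j < length v \<Longrightarrow> I j s \<Longrightarrow> I (Suc j) (exec v c (setv h j s))"
    and "\<And>s. I (length v) s \<Longrightarrow> Q (setv h (length v) s)"
  shows "Q (exec v (Loop h c) s)"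
  unfolding exec.simps by (rule assms(3), rule fold_upt_induct[where I = I]) (use assms in auto)

lemma calc_ge_correct:
  assumes "fst s vZ = 0" "fst s vN = n" "fst s x = i" "i < length v" "x < 5" "x \<noteq> 0"
  shows "fst (exec v (calc_ge x) s) r_ge = 0 \<longleftrightarrow> i < n"
  unfolding calc_ge_def exec.simps(5)
  by (rule exec_Loop_induct[where I = "\<lambda>j s. fst s vZ = 0 \<and> fst s vN = n \<and> fst s x = i \<and>
      fst s vC = (if n < j then 1 else 0) \<and> (i < j \<longrightarrow> (fst s r_ge = 0 \<longleftrightarrow> i < n)) "])
    (use assms in \<open>auto simp: min_def split: if_splits\<close>)

lemma calc_edge_correct:
  assumes "fst s vZ = 0" "fst s vN = n" "fst s y = i" "i < length v" "y < 5" "y \<noteq> 0" "n < length v"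
  shows "fst (exec v (calc_edge y) s) r_edge = 0 \<longleftrightarrow> \<not> (Suc n dvd i \<and> i \<noteq> 0)"
  unfolding calc_edge_def exec.simps(5)
proof (rule exec_Loop_induct[where I = "\<lambda>j s. fst s vZ = 0 \<and> fst s vN = n \<and> fst s y = i \<and>
      fst s vC = j mod Suc n \<and> (fst s r_edge = 0 \<longleftrightarrow> \<not> (i < j \<and> Suc n dvd i \<and> i \<noteq> 0))"], goal_cases)
  case (2 j s)
  define r where "r = j mod Suc n"
  let ?s' = "exec v (Semi (IfEq vG y (IfEq vC vZ (IfEq vG vZ Skip (Inc r_edge)) Skip) Skip)
        (IfEq vC vN (Copy vC vZ) (Inc vC))) (setv vG j s)"
  have s: "fst s vZ = 0" "fst s vN = n" "fst s y = i" "fst s vC = r"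
    using 2 by (simp_all add: r_def)
  have "r < Suc n" unfolding r_def by (rule mod_less_divisor) simp
  then have "min (Suc r) (length v) = Suc r" using assms(7) by simp
  then have "fst ?s' vC = (if r = n then 0 else Suc r)"
    using s assms(5,6) by simp
  then have "fst ?s' vC = Suc j mod Suc n"
    by (simp only: mod_Suc r_def) simp
  moreover have "fst ?s' vZ = 0" "fst ?s' vN = n" "fst ?s' y = i"
    using s assms(5,6) by simp_all
  moreover have "fst ?s' r_edge = (if j = i \<and> r = 0 \<and> j \<noteq> 0 then min (Suc (fst s r_edge)) (length v) else fst s r_edge)"
    using s assms(5,6) by simp
  moreover have "min (Suc (fst s r_edge)) (length v) \<noteq> 0"
    using assms(4) by auto
  moreover have "Suc n dvd j \<longleftrightarrow> r = 0"
    by (simp add: dvd_eq_mod_eq_0 r_def)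
  ultimately show ?case
    using 2(2) less_Suc_eq[of i j] by metis
qed (use assms in auto)

text \<open>The sum saturates at \<open>length v\<close>. Comparing it with a position
  \<open>j < length v\<close> is still exact.\<close>

lemma calc_sum_correct:
  assumes "fst s vZ = 0" "fst s x = i" "i < length v" "x < 5" "x \<noteq> 0"
  shows "fst (exec v (calc_sum x) s) vT = min (fst s vD + 2 + i) (length v)"
  unfolding calc_sum_def exec.simps(5)
  by (rule exec_Loop_induct[where I = "\<lambda>j s'. fst s' x = i \<and>
      fst s' vS = min i j \<and> fst s' vT = min (fst s vD + 2 + min i j) (length v)"])
    (use assms in \<open>auto simp: min_def split: if_splits\<close>)

lemma calc_mem_correct:
  assumes "fst s vZ = 0" "fst s x = i" "fst s y = j" "i < length v" "j < length v"
    "x < 5" "x \<noteq> 0" "y < 5" "y \<noteq> 0"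
  shows "fst (exec v (calc_mem x y) s) r_mem = 0 \<longleftrightarrow> \<not> (\<exists>d<length v. v ! d \<and> d + 2 + i = j)"
proof -
  define I where "I m s \<longleftrightarrow> fst s vZ = 0 \<and> fst s x = i \<and> fst s y = j \<and>
    (fst s r_mem = 0 \<longleftrightarrow> \<not> (\<exists>d<m. v ! d \<and> d + 2 + i = j))" for m :: nat and s :: cstate
  have "I (Suc m) (exec v (IfBit vD True (Semi (calc_sum x) (IfEq vT y (Inc r_mem) Skip)) Skip) (setv vD m s))"
    if m: "m < length v" and I: "I m s" for m s
  proof -
    let ?s = "setv vD m s"
    let ?s' = "exec v (calc_sum x) ?s"
    have unwritten: "fst ?s' h = fst ?s h" if "h \<notin> {5, 6, 7}" for h
      by (rule exec_not_written) (use that in \<open>auto simp: calc_sum_def\<close>)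
    have "fst ?s' vT = min (m + 2 + i) (length v)"
      using calc_sum_correct[of ?s x i v] I assms by (auto simp: I_def)
    then show ?thesis
      using I m assms unwritten[of 1] unwritten[of x] unwritten[of y] unwritten[of 12]
      by (auto simp: I_def less_Suc_eq min_def)
  qed
  note step = this
  show ?thesis
    unfolding calc_mem_def exec.simps(5)
    by (rule exec_Loop_induct[where I = I, OF _ step]) (use assms in \<open>auto simp: I_def\<close>)
qed

definition ready :: "nat \<Rightarrow> cstate \<Rightarrow> bool" where
  "ready n s \<longleftrightarrow> fst s vZ = 0 \<and> fst s vN = n"

lemma ready_exec: "ready n s \<Longrightarrow> 1 \<notin> writes c \<Longrightarrow> 2 \<notin> writes c \<Longrightarrow> ready n (exec v c s)"
  by (simp add: ready_def exec_not_written)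

lemma emit_mixed_correct:
  assumes "ready n s" "fst s x = i" "fst s y = j" "i < length v" "j < length v" "n < length v"
    "x \<in> {3, 4}" "y \<in> {3, 4}"
  shows "snd (exec v (emit_mixed t x t' y) s) = snd s @ [mixed_adj v n t i t' j]"
proof -
  define s1 where "s1 = exec v (calc_ge x) s"
  define s2 where "s2 = exec v (calc_edge y) s1"
  define s3 where "s3 = exec v (calc_mem x y) s2"
  have keep1: "fst s1 h = fst s h" if "h \<notin> {5, 9, 10}" for h
    unfolding s1_def by (rule exec_not_written) (use that in \<open>auto simp: calc_ge_def\<close>)
  have keep2: "fst s2 h = fst s1 h" if "h \<notin> {5, 9, 11}" for h
    unfolding s2_def by (rule exec_not_written) (use that in \<open>auto simp: calc_edge_def\<close>)
  have keep3: "fst s3 h = fst s2 h" if "h \<notin> {5, 6, 7, 8, 12}" for h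
    unfolding s3_def by (rule exec_not_written) (use that in \<open>auto simp: calc_mem_def calc_sum_def\<close>)
  have xy: "x < 5" "x \<noteq> 0" "y < 5" "y \<noteq> 0"
      "x \<notin> {5, 9, 10}" "x \<notin> {5, 9, 11}" "x \<notin> {5, 6, 7, 8, 12}"
      "y \<notin> {5, 9, 10}" "y \<notin> {5, 9, 11}" "y \<notin> {5, 6, 7, 8, 12}"
    using assms(7,8) by auto
  have "fst s1 r_ge = 0 \<longleftrightarrow> i < n"
    unfolding s1_def by (rule calc_ge_correct) (use assms xy in \<open>auto simp: ready_def\<close>)
  then have ge: "fst s3 r_ge = 0 \<longleftrightarrow> i < n"
    by (simp add: keep2 keep3)
  have "fst s2 r_edge = 0 \<longleftrightarrow> \<not> (Suc n dvd j \<and> j \<noteq> 0)"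
    unfolding s2_def by (rule calc_edge_correct) (use assms xy in \<open>simp_all add: ready_def keep1\<close>)
  then have edge: "fst s3 r_edge = 0 \<longleftrightarrow> \<not> (Suc n dvd j \<and> j \<noteq> 0)"
    by (simp add: keep3)
  have mem: "fst s3 r_mem = 0 \<longleftrightarrow> \<not> (\<exists>d<length v. v ! d \<and> d + 2 + i = j)"
    unfolding s3_def by (rule calc_mem_correct) (use assms xy in \<open>simp_all add: ready_def keep1 keep2\<close>)
  have x: "fst s3 x = i" and y: "fst s3 y = j" and z: "fst s3 vZ = 0"
    using assms xy by (simp_all add: keep1 keep2 keep3 ready_def)
  have out: "snd s3 = snd s"
    unfolding s3_def s2_def s1_def
    by (simp add: exec_silent calc_ge_def calc_edge_def calc_mem_def calc_sum_def del: exec.simps)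
  obtain E where E: "E \<longleftrightarrow> Suc n dvd j \<and> j \<noteq> 0" by blast
  obtain M where M: "M \<longleftrightarrow> (\<exists>d<length v. v ! d \<and> d + 2 + i = j)" by blast
  have "exec v (emit_mixed t x t' y) s = exec v (if t' = 3
      then IfEq r_edge vZ (emit_forced t x y)
        (IfEq r_ge vZ (IfEq r_mem vZ (Out False) (Out (t = 0))) (Out False))
      else emit_forced t x y) s3"
    by (simp only: emit_mixed_def exec.simps(5) s1_def s2_def s3_def)
  moreover have "mixed_adj v n t i t' j \<longleftrightarrow>
      (if t' = 3 \<and> E then t = 0 \<and> i < n \<and> M else i = j \<and> t = (if i < n then 1 else 0))"
    by (simp only: mixed_adj_def E M conj_assoc)
  moreover have "fst s3 r_ge = 0 \<longleftrightarrow> i < n" "fst s3 r_edge = 0 \<longleftrightarrow> \<not> E" "fst s3 r_mem = 0 \<longleftrightarrow> \<not> M"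
    using ge edge mem by (simp_all only: E M)
  ultimately show ?thesis
    using z by (cases "i < n"; cases E; cases M) (auto simp: emit_forced_def x y out)
qed

lemma emit_cell_correct:
  assumes "ready n s" "fst s vH = i" "fst s vI = j" "i < length v" "j < length v" "n < length v"
    "t < 4" "t' < 4"
  shows "snd (exec v (emit_cell t t') s) = snd s @ [adj v n (4 * i + t) (4 * j + t')]"
  using assms by (auto simp: emit_cell_def adj_def emit_mixed_correct)

lemma exec_Loop_out:
  assumes "\<And>j s. j < length v \<Longrightarrow> I s \<Longrightarrow> fst s h = j \<Longrightarrow> snd (exec v c s) = snd s @ g j"
    and "\<And>s. I s \<Longrightarrow> I (exec v c s)" and "\<And>s j. I s \<Longrightarrow> I (setv h j s)" and "I s"
  shows "snd (exec v (Loop h c) s) = snd s @ concat (map g [0..<length v])"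
  by (rule exec_Loop_induct[where I = "\<lambda>j s'. I s' \<and> snd s' = snd s @ concat (map g [0..<j])"])
    (use assms in auto)

text \<open>Vertices are printed in groups of four, one group per input position, while the encoding
  lists them consecutively.\<close>

lemma concat_map_upt_4:
  "concat (map f [0..<4 * L]) =
    concat (map (\<lambda>h. f (4 * h) @ f (4 * h + 1) @ f (4 * h + 2) @ f (4 * h + 3)) [0..<L])"
proof (induction L)
  case (Suc L)
  have "[0..<4 * Suc L] = [0..<4 * L] @ [4 * L, 4 * L + 1, 4 * L + 2, 4 * L + 3]"
    by (simp add: upt_rec[of "4 * L"] upt_rec[of "Suc (4 * L)"] numeral_eq_Suc)
  with Suc show ?case by simp
qed simp

lemma map_upt_4:
  "map f [0..<4 * L] = concat (map (\<lambda>h. [f (4 * h), f (4 * h + 1), f (4 * h + 2), f (4 * h + 3)]) [0..<L])"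
  using concat_map_upt_4[of "\<lambda>i. [f i]" L] by simp

lemma writes_emit_cell: "writes (emit_cell t t') \<subseteq> {5..12}"
  by (auto simp: emit_graph_defs)

lemma exec_emit_cell_keep: "h < 5 \<Longrightarrow> fst (exec v (emit_cell t t') s) h = fst s h"
  by (rule exec_not_written) (use writes_emit_cell[of t t'] in auto)

lemma emit_row_correct:
  assumes "ready n s" "fst s vH = i" "i < length v" "n < length v" "t < 4"
  shows "snd (exec v (emit_row t) s) = snd s @ map (adj v n (4 * i + t)) [0..<4 * length v]"
  unfolding emit_row_def map_upt_4
proof (rule exec_Loop_out[where I = "\<lambda>s. ready n s \<and> fst s vH = i"])
  fix j s
  assume "j < length v" "ready n s \<and> fst s vH = i" "fst s vI = j"
  then show "snd (exec v (Semi (emit_cell t 0) (Semi (emit_cell t 1) (Semi (emit_cell t 2) (emit_cell t 3)))) s)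
    = snd s @ [adj v n (4 * i + t) (4 * j), adj v n (4 * i + t) (4 * j + 1),
        adj v n (4 * i + t) (4 * j + 2), adj v n (4 * i + t) (4 * j + 3)]"
    using emit_cell_correct[of n _ i j v t] assms
    by (simp add: ready_def exec_emit_cell_keep)
qed (use assms in \<open>auto simp: ready_def exec_emit_cell_keep\<close>)

lemma calc_n_correct:
  assumes "v = xs @ False # replicate n True" "fst s vZ = 0"
  shows "fst (exec v calc_n s) vN = n"
proof -
  let ?m = "Suc (length xs)"
  have L: "length v = ?m + n" using assms by simp
  show ?thesis
    unfolding calc_n_def exec.simps(5)
  \<comment> \<open>Nothing is claimed about the count before the separating zero, which resets it
    whatever it was.\<close>
  proof (rule exec_Loop_induct[where I = "\<lambda>j s. fst s vZ = 0 \<and> (?m \<le> j \<longrightarrow> fst s vN = j - ?m)"], goal_cases)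
    case (2 j s)
    have "v ! j \<longleftrightarrow> length xs < j" if "length xs \<le> j"
      using that 2(1) L assms(1) by (cases "j = length xs") (auto simp: nth_append nth_Cons split: nat.splits)
    then show ?case using 2 L by (auto simp: min_def)
  qed (use assms L in auto)
qed

theorem emit_graph_correct:
  assumes "v = xs @ False # replicate n True"
  shows "snd (exec v emit_graph (\<lambda>_. 0, [])) = enc_graph (4 * length v) (adj v n)"
proof -
  let ?L = "length v"
  define s1 where "s1 = exec v calc_n (\<lambda>_. 0, [])"
  define s2 where "s2 = exec v (Loop vH (Semi (Out True) (Semi (Out True) (Semi (Out True) (Out True))))) s1"
  define s3 where "s3 = exec v (Out False) s2"
  have "ready n s1"
    using calc_n_correct[OF assms, of "(\<lambda>_. 0, [])"] unfolding ready_def s1_def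
    by (auto simp: exec_not_written calc_n_def simp del: exec.simps)
  then have ready: "ready n s3"
    unfolding s3_def s2_def by (auto intro!: ready_exec simp del: exec.simps)
  have "snd s1 = []"
    unfolding s1_def by (simp add: exec_silent calc_n_def del: exec.simps)
  moreover have "snd s2 = snd s1 @ concat (map (\<lambda>_. [True, True, True, True]) [0..<?L])"
    unfolding s2_def by (rule exec_Loop_out[where I = "\<lambda>_. True"]) auto
  moreover have "concat (map (\<lambda>_. [True, True, True, True]) [0..<?L]) = replicate (4 * ?L) True"
    using map_upt_4[of "\<lambda>_. True" ?L] by (simp add: map_replicate_const)
  ultimately have out: "snd s3 = replicate (4 * ?L) True @ [False]"
    by (simp add: s3_def)
  have "snd (exec v (Loop vH (Semi (emit_row 0) (Semi (emit_row 1) (Semi (emit_row 2) (emit_row 3))))) s3)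
    = snd s3 @ concat (map (\<lambda>i. map (adj v n i) [0..<4 * ?L]) [0..<4 * ?L])"
    unfolding concat_map_upt_4
  proof (rule exec_Loop_out[where I = "ready n"])
    have keep: "fst (exec v (emit_row t) s) h = fst s h" if "h < 4" for h t s
      by (rule exec_not_written) (use that writes_emit_cell[of t] in \<open>fastforce simp: emit_row_def\<close>)
    then show "ready n (exec v (Semi (emit_row 0) (Semi (emit_row 1) (Semi (emit_row 2) (emit_row 3)))) s)"
      if "ready n s" for s
      using that by (simp add: ready_def)
    fix i s
    assume "i < ?L" "ready n s" "fst s vH = i"
    moreover have "n < ?L" using assms by simp
    ultimately show "snd (exec v (Semi (emit_row 0) (Semi (emit_row 1) (Semi (emit_row 2) (emit_row 3)))) s)
      = snd s @ map (adj v n (4 * i)) [0..<4 * ?L] @ map (adj v n (4 * i + 1)) [0..<4 * ?L] @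
        map (adj v n (4 * i + 2)) [0..<4 * ?L] @ map (adj v n (4 * i + 3)) [0..<4 * ?L]"
      using emit_row_correct[of n _ i v] keep by (simp add: ready_def)
  qed (use ready in \<open>auto simp: ready_def\<close>)
  then show ?thesis
    unfolding emit_graph_def exec.simps(5) s1_def[symmetric] s2_def[symmetric] s3_def[symmetric]
    by (simp add: out enc_graph_def)
qed

section \<open>Minimal connected dominating sets of the split graph\<close>

text \<open>A set inside the clique that hits all neighbourhoods dominates and is connected.
  Conversely, the clique part of any connected dominating set hits all neighbourhoods, so discarding
  the independent vertices of a solution leaves a solution and minimal ones contain none.\<close>

lemma min_cds_split_graph:
  assumes V: "K \<union> I = {0..<n}" "K \<inter> I = {}"
    and clique: "\<And>u v. u \<in> K \<Longrightarrow> v \<in> K \<Longrightarrow> u \<noteq> v \<Longrightarrow> E u v"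
    and indep: "\<And>u v. u \<in> I \<Longrightarrow> v \<in> I \<Longrightarrow> \<not> E u v"
    and two: "a \<in> I" "b \<in> I" "a \<noteq> b"
  shows "is_min_cds n E D \<longleftrightarrow> min_hitting_set K ((\<lambda>y. {x \<in> K. E y x}) ` I) D"
proof -
  let ?\<N> = "(\<lambda>y. {x \<in> K. E y x}) ` I"
  have cds: "is_cds n E D" if hs: "hitting_set K ?\<N> D" for D
  proof -
    have "D \<subseteq> K" using hs by (simp add: hitting_set_def)
    have hit: "\<exists>u\<in>D. E y u" if "y \<in> I" for y
      using hs that by (fastforce simp: hitting_set_def)
    then obtain u0 where "u0 \<in> D" using two(1) by blast
    have "\<exists>u\<in>D. E v u" if "v \<in> {0..<n} - D" for v
    proof (cases "v \<in> I")
      case False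
      then have "v \<in> K" using that V by blast
      then show ?thesis using \<open>u0 \<in> D\<close> \<open>D \<subseteq> K\<close> clique that by blast
    qed (use hit in blast)
    moreover have "(\<lambda>x y. x \<in> D \<and> y \<in> D \<and> E x y)\<^sup>*\<^sup>* u v" if "u \<in> D" "v \<in> D" for u v
    proof (cases "u = v")
      case False
      then have "E u v" using that \<open>D \<subseteq> K\<close> clique by blast
      then show ?thesis using that by (intro r_into_rtranclp) simp
    qed simp
    ultimately show ?thesis
      unfolding is_cds_def connected_induced_def using \<open>u0 \<in> D\<close> \<open>D \<subseteq> K\<close> V by blast
  qed
  have hs: "hitting_set K ?\<N> (D \<inter> K)" if cds: "is_cds n E D" for D
  proof -
    have D: "D \<subseteq> {0..<n}" and dom: "\<And>v. v \<in> {0..<n} \<Longrightarrow> v \<notin> D \<Longrightarrow> \<exists>u\<in>D. E v u"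
      and con: "\<And>u v. u \<in> D \<Longrightarrow> v \<in> D \<Longrightarrow> (\<lambda>x y. x \<in> D \<and> y \<in> D \<and> E x y)\<^sup>*\<^sup>* u v"
      using cds by (auto simp: is_cds_def connected_induced_def)
    have "\<exists>u\<in>D. E y u" if y: "y \<in> I" for y
    proof (cases "y \<in> D")
      case True
      \<comment> \<open>The second independent vertex is in \<open>D\<close> or dominated by a
        vertex other than \<open>y\<close>, so \<open>D\<close> is more than \<open>{y}\<close>; the
        first edge of a path leaving \<open>y\<close> then gives a neighbour of \<open>y\<close> in
        \<open>D\<close>.\<close>
      obtain y' where y': "y' \<in> I" "y' \<noteq> y" using two by metis
      obtain u where "u \<in> D" "u \<noteq> y"
        using dom[of y'] y y' indep V by blast
      with con[OF True \<open>u \<in> D\<close>] show ?thesis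
        by (auto elim: converse_rtranclpE)
    qed (use dom y V in blast)
    then show ?thesis
      using D V indep unfolding hitting_set_def by blast
  qed
  show ?thesis
  proof
    assume min: "is_min_cds n E D"
    then have "is_cds n E (D \<inter> K)" using cds hs by (simp add: is_min_cds_def)
    then have "D \<inter> K = D" using min by (auto simp: is_min_cds_def)
    then show "min_hitting_set K ?\<N> D"
      using min hs[of D] cds by (auto simp: is_min_cds_def min_hitting_set_def)
  next
    assume min: "min_hitting_set K ?\<N> D"
    have "\<not> is_cds n E D'" if "D' \<subset> D" for D'
    proof
      assume "is_cds n E D'"
      then have "hitting_set K ?\<N> (D' \<inter> K)" by (rule hs)
      moreover have "D' \<inter> K \<subset> D" using that by blast
      ultimately show False using min by (auto simp: min_hitting_set_def)
    qed
    then show "is_min_cds n E D"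
      using min cds by (auto simp: is_min_cds_def min_hitting_set_def)
  qed
qed

text \<open>A row of the input is a leading \<open>True\<close> followed by the membership bits.
  Reversed and ending just before \<open>y\<close>, it has that \<open>True\<close> at
  \<open>y - 1\<close> and the bit of \<open>i\<close> at \<open>y - 2 - i\<close>, hence the offset
  2.\<close>

definition edge_at :: "bool list \<Rightarrow> nat \<Rightarrow> nat \<Rightarrow> nat set" where
  "edge_at v n y = {i. i < n \<and> (\<exists>d<length v. v ! d \<and> d + 2 + i = y)}"

definition edge_positions :: "bool list \<Rightarrow> nat \<Rightarrow> nat set" where
  "edge_positions v n = {y. y < length v \<and> Suc n dvd y \<and> y \<noteq> 0}"

text \<open>For \<open>h \<ge> n\<close> the pendant must be dominated too, but without setting bit
  \<open>4 * h + 1\<close>, since that bit tells the filter that \<open>h\<close> is a hypergraph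
  vertex.\<close>

definition forced :: "nat \<Rightarrow> nat \<Rightarrow> nat" where
  "forced n h = (if h < n then 4 * h + 1 else 4 * h)"

definition embed :: "bool list \<Rightarrow> nat \<Rightarrow> nat set \<Rightarrow> nat set" where
  "embed v n H = forced n ` {..<length v} \<union> (\<lambda>i. 4 * i) ` H"

definition clique_part :: "bool list \<Rightarrow> nat set" where
  "clique_part v = {u. u < 4 * length v \<and> u mod 4 < 2}"

definition indep_part :: "bool list \<Rightarrow> nat set" where
  "indep_part v = {u. u < 4 * length v \<and> 2 \<le> u mod 4}"

lemma adj_graph: "is_graph (4 * length v) (adj v n)"
  by (auto simp: is_graph_def adj_def)

lemma adj_clique: "u \<in> clique_part v \<Longrightarrow> w \<in> clique_part v \<Longrightarrow> u \<noteq> w \<Longrightarrow> adj v n u w"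
  by (simp add: clique_part_def adj_def)

lemma adj_indep: "u \<in> indep_part v \<Longrightarrow> w \<in> indep_part v \<Longrightarrow> \<not> adj v n u w"
  by (simp add: indep_part_def adj_def)

lemma clique_indep_part: "clique_part v \<union> indep_part v = {0..<4 * length v}" "clique_part v \<inter> indep_part v = {}"
  by (auto simp: clique_part_def indep_part_def)

lemma adj_split: "split_graph (4 * length v) (adj v n)"
  unfolding split_graph_def
  by (rule exI[of _ "clique_part v"], rule exI[of _ "indep_part v"])
    (use clique_indep_part adj_clique adj_indep in auto)

lemma four_mult_add: "(t::nat) < 4 \<Longrightarrow> (4 * h + t) mod 4 = t" "t < 4 \<Longrightarrow> (4 * h + t) div 4 = h"
  by simp_all

lemma neighbours:
  assumes "h < length v" "n < length v"
  shows "{x \<in> clique_part v. adj v n (4 * h + 2) x} = {forced n h}"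
    and "h \<in> edge_positions v n \<Longrightarrow>
      {x \<in> clique_part v. adj v n (4 * h + 3) x} = (\<lambda>i. 4 * i) ` edge_at v n h"
    and "h \<notin> edge_positions v n \<Longrightarrow> {x \<in> clique_part v. adj v n (4 * h + 3) x} = {forced n h}"
proof -
  have *: "x \<in> clique_part v \<and> adj v n (4 * h + t') x \<longleftrightarrow>
      (\<exists>i t. x = 4 * i + t \<and> t < 2 \<and> i < length v \<and> mixed_adj v n t i t' h)"
    if "t' = 2 \<or> t' = 3" for x t'
  proof
    assume "x \<in> clique_part v \<and> adj v n (4 * h + t') x"
    then have "x mod 4 < 2" "x div 4 < length v" "mixed_adj v n (x mod 4) (x div 4) t' h"
      using that by (auto simp: clique_part_def adj_def split: if_splits)
    moreover have "x = 4 * (x div 4) + x mod 4" by simp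
    ultimately show "\<exists>i t. x = 4 * i + t \<and> t < 2 \<and> i < length v \<and> mixed_adj v n t i t' h"
      by metis
  next
    assume "\<exists>i t. x = 4 * i + t \<and> t < 2 \<and> i < length v \<and> mixed_adj v n t i t' h"
    then obtain i t where "x = 4 * i + t" "t < 2" "i < length v" "mixed_adj v n t i t' h" by blast
    then show "x \<in> clique_part v \<and> adj v n (4 * h + t') x"
      using that by (auto simp: clique_part_def adj_def)
  qed
  show "{x \<in> clique_part v. adj v n (4 * h + 2) x} = {forced n h}"
    using *[of 2] assms by (auto simp: mixed_adj_def forced_def)
  show "{x \<in> clique_part v. adj v n (4 * h + 3) x} = {forced n h}" if "h \<notin> edge_positions v n"
    using *[of 3] assms that by (auto simp: mixed_adj_def forced_def edge_positions_def)
  show "{x \<in> clique_part v. adj v n (4 * h + 3) x} = (\<lambda>i. 4 * i) ` edge_at v n h"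
    if "h \<in> edge_positions v n"
    using *[of 3] assms that by (auto simp: mixed_adj_def edge_positions_def edge_at_def)
qed

lemma indep_part_eq: "indep_part v = (\<lambda>h. 4 * h + 2) ` {..<length v} \<union> (\<lambda>h. 4 * h + 3) ` {..<length v}"
proof (intro set_eqI iffI)
  fix u
  assume "u \<in> indep_part v"
  then have "u div 4 < length v" "u mod 4 = 2 \<or> u mod 4 = 3" by (auto simp: indep_part_def)
  then show "u \<in> (\<lambda>h. 4 * h + 2) ` {..<length v} \<union> (\<lambda>h. 4 * h + 3) ` {..<length v}"
    using mult_div_mod_eq[of 4 u] by (metis UnCI image_eqI lessThan_iff)
next
  fix u
  assume "u \<in> (\<lambda>h. 4 * h + 2) ` {..<length v} \<union> (\<lambda>h. 4 * h + 3) ` {..<length v}"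
  then obtain h where "h < length v" "u = 4 * h + 2 \<or> u = 4 * h + 3" by blast
  then show "u \<in> indep_part v"
    by (auto simp: indep_part_def four_mult_add simp del: add_2_eq_Suc' Suc_eq_plus1)
qed

text \<open>The one-element neighbourhoods turn into membership of the forced vertices; what remains
  are the hyperedges, copied to the vertices \<open>4 * i\<close>.\<close>

lemma hitting_set_adj:
  assumes "n < length v"
  shows "hitting_set (clique_part v) ((\<lambda>y. {x \<in> clique_part v. adj v n y x}) ` indep_part v) D \<longleftrightarrow>
    D \<subseteq> clique_part v \<and> forced n ` {..<length v} \<subseteq> D \<and>
    (\<forall>y\<in>edge_positions v n. \<exists>i\<in>edge_at v n y. 4 * i \<in> D)"
    (is "?L \<longleftrightarrow> ?R")
proof
  assume L: ?L
  have "forced n h \<in> D" if "h < length v" for h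
  proof -
    have "4 * h + 2 \<in> indep_part v" using that by (auto simp: indep_part_eq)
    then have "D \<inter> {x \<in> clique_part v. adj v n (4 * h + 2) x} \<noteq> {}"
      using L by (simp only: hitting_set_def) blast
    then show ?thesis using neighbours(1)[OF that assms] by auto
  qed
  moreover have "\<exists>i\<in>edge_at v n y. 4 * i \<in> D" if y: "y \<in> edge_positions v n" for y
  proof -
    have y': "y < length v" using y by (simp add: edge_positions_def)
    then have "4 * y + 3 \<in> indep_part v" by (auto simp: indep_part_eq)
    then have "D \<inter> {x \<in> clique_part v. adj v n (4 * y + 3) x} \<noteq> {}"
      using L by (simp only: hitting_set_def) blast
    then show ?thesis using neighbours(2)[OF y' assms y] by auto
  qed
  ultimately show ?R using L by (auto simp: hitting_set_def)
next
  assume R: ?R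
  have "D \<inter> {x \<in> clique_part v. adj v n y x} \<noteq> {}" if "y \<in> indep_part v" for y
  proof -
    from that obtain h where h: "h < length v" and y: "y = 4 * h + 2 \<or> y = 4 * h + 3"
      by (auto simp: indep_part_eq)
    have f: "forced n h \<in> D" using R h by blast
    from y show ?thesis
    proof
      assume "y = 4 * h + 2"
      then show ?thesis using neighbours(1)[OF h assms] f by simp
    next
      assume y: "y = 4 * h + 3"
      show ?thesis
      proof (cases "h \<in> edge_positions v n")
        case True
        then obtain i where "i \<in> edge_at v n h" "4 * i \<in> D" using R by blast
        then show ?thesis unfolding y neighbours(2)[OF h assms True] by blast
      next
        case False
        then show ?thesis unfolding y neighbours(3)[OF h assms False] using f by blast
      qed
    qed
  qed
  then show ?L using R by (auto simp: hitting_set_def)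
qed

lemma four_mult_in_embed: "i < n \<Longrightarrow> 4 * i \<in> embed v n H \<longleftrightarrow> i \<in> H"
proof -
  assume "i < n"
  then have "4 * i \<notin> forced n ` {..<length v}"
    by (auto simp: forced_def split: if_splits; presburger)
  then show ?thesis by (auto simp: embed_def)
qed

text \<open>Both \<open>embed\<close> and \<open>pull\<close> preserve hitting sets; moreover
  \<open>pull\<close> undoes \<open>embed\<close> on subsets of \<open>{0..<n}\<close>, and
  \<open>embed v n (pull D) \<subseteq> D\<close>. This makes the minimal elements of the two sides
  correspond. An empty hyperedge gives an isolated vertex, and then neither side has a
  solution.\<close>

lemma min_cds_adj:
  assumes n: "n < length v"
  shows "is_min_cds (4 * length v) (adj v n) D \<longleftrightarrow>
    (\<exists>H. min_hitting_set {0..<n} (edge_at v n ` edge_positions v n) H \<and> D = embed v n H)"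
proof -
  let ?\<N> = "(\<lambda>y. {x \<in> clique_part v. adj v n y x}) ` indep_part v"
  let ?\<E> = "edge_at v n ` edge_positions v n"
  define pull where "pull D = {i. i < n \<and> 4 * i \<in> D}" for D :: "nat set"
  \<comment> \<open>Input position 0 always exists, so the vertices 2 and 3 serve as the two
    independent vertices.\<close>
  have "3 < 4 * length v" using n by linarith
  then have "2 \<in> indep_part v" "3 \<in> indep_part v" unfolding indep_part_def by simp_all
  then have min_cds: "is_min_cds (4 * length v) (adj v n) D \<longleftrightarrow> min_hitting_set (clique_part v) ?\<N> D" for D
    by (intro min_cds_split_graph[where a = 2 and b = 3] clique_indep_part adj_clique adj_indep) auto
  have F: "forced n ` {..<length v} \<subseteq> clique_part v"
    by (auto simp: forced_def clique_part_def)
  have down: "hitting_set {0..<n} ?\<E> (pull D)" "embed v n (pull D) \<subseteq> D"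
    if "hitting_set (clique_part v) ?\<N> D" for D
    using that unfolding hitting_set_adj[OF n]
    by (fastforce simp: hitting_set_def pull_def embed_def edge_at_def)+
  have up: "hitting_set (clique_part v) ?\<N> (embed v n H)" if "hitting_set {0..<n} ?\<E> H" for H
  proof -
    have "(\<lambda>i. 4 * i) ` H \<subseteq> clique_part v"
      using that n by (auto simp: hitting_set_def clique_part_def)
    moreover have "\<exists>i\<in>edge_at v n y. 4 * i \<in> embed v n H" if "y \<in> edge_positions v n" for y
      using \<open>hitting_set {0..<n} ?\<E> H\<close> that by (fastforce simp: hitting_set_def embed_def)
    ultimately show ?thesis
      unfolding hitting_set_adj[OF n] using F by (auto simp: embed_def)
  qed
  have pull_embed: "pull (embed v n H) = H" if "H \<subseteq> {0..<n}" for H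
    using that four_mult_in_embed[of _ n v H] by (auto simp: pull_def)
  have embed_mono: "embed v n H \<subseteq> embed v n H'" if "H \<subseteq> H'" for H H'
    using that by (auto simp: embed_def)
  show ?thesis
    unfolding min_cds
  proof (intro iffI)
    assume min: "min_hitting_set (clique_part v) ?\<N> D"
    then have "hitting_set (clique_part v) ?\<N> D" by (simp add: min_hitting_set_def)
    then have P: "hitting_set {0..<n} ?\<E> (pull D)" "embed v n (pull D) \<subseteq> D" by (rule down)+
    then have D: "D = embed v n (pull D)"
      using up min by (auto simp: min_hitting_set_def)
    have "\<not> hitting_set {0..<n} ?\<E> H'" if "H' \<subset> pull D" for H'
    proof
      assume H': "hitting_set {0..<n} ?\<E> H'"
      then have "embed v n H' \<noteq> embed v n (pull D)"
        using that pull_embed[of H'] pull_embed[of "pull D"] P(1) H'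
        by (metis hitting_set_def psubset_eq)
      then have "embed v n H' \<subset> D" using embed_mono[of H' "pull D"] that D by auto
      then show False using min up[OF H'] by (simp add: min_hitting_set_def)
    qed
    then show "\<exists>H. min_hitting_set {0..<n} ?\<E> H \<and> D = embed v n H"
      using P D by (auto simp: min_hitting_set_def)
  next
    assume "\<exists>H. min_hitting_set {0..<n} ?\<E> H \<and> D = embed v n H"
    then obtain H where H: "min_hitting_set {0..<n} ?\<E> H" and D: "D = embed v n H" by blast
    have "H \<subseteq> {0..<n}" using H by (simp add: min_hitting_set_def hitting_set_def)
    have "\<not> hitting_set (clique_part v) ?\<N> D'" if D': "D' \<subset> D" for D'
    proof
      assume hs: "hitting_set (clique_part v) ?\<N> D'"
      have "pull D' \<subseteq> H"
        using D' pull_embed[OF \<open>H \<subseteq> {0..<n}\<close>] unfolding D by (auto simp: pull_def)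
      then have "pull D' = H" using H down(1)[OF hs] by (auto simp: min_hitting_set_def)
      then show False using down(2)[OF hs] D' D by blast
    qed
    then show "min_hitting_set (clique_part v) ?\<N> D"
      using up H D by (auto simp: min_hitting_set_def)
  qed
qed

fun selected :: "bool list \<Rightarrow> bool list" where
  "selected (a # b # xs) = (if b then a # selected xs else selected xs)"
| "selected _ = []"

text \<open>The four bits of position \<open>h\<close> are \<open>h \<in> H\<close>, 1, 0, 0 if
  \<open>h < n\<close>, and 1, 0, 0, 0 otherwise. Among the pairs read by the filter, exactly the
  first one of each \<open>h < n\<close> has second bit 1.\<close>

lemma selected_charvec_embed:
  assumes "n \<le> length v" "H \<subseteq> {0..<n}"
  shows "selected (charvec (4 * length v) (embed v n H)) = charvec n H"
proof -
  let ?S = "embed v n H"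
  have 1: "4 * h + 1 \<in> ?S \<longleftrightarrow> h < n" if "h < length v" for h
  proof -
    have "h < n" if "4 * h + 1 \<in> ?S"
      using that by (auto simp: embed_def forced_def split: if_splits; presburger)
    then show ?thesis using \<open>h < length v\<close> by (auto simp: embed_def forced_def)
  qed
  have 2: "4 * h + 2 \<notin> ?S" "4 * h + 3 \<notin> ?S" for h
    by (auto simp: embed_def forced_def split: if_splits; presburger)+
  have sel: "selected (concat (map (\<lambda>h. [4 * h \<in> ?S, 4 * h + 1 \<in> ?S, 4 * h + 2 \<in> ?S, 4 * h + 3 \<in> ?S]) hs))
      = map (\<lambda>h. h \<in> H) (filter (\<lambda>h. h < n) hs)" if "set hs \<subseteq> {..<length v}" for hs
    using that by (induction hs) (simp_all del: One_nat_def add: 1 2 four_mult_in_embed)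
  have "filter (\<lambda>h. h < n) [0..<length v] = [0..<n]"
  proof -
    have "[0..<length v] = [0..<n] @ [n..<length v]"
      using assms upt_add_eq_append[of 0 n "length v - n"] by simp
    then show ?thesis by simp
  qed
  then show ?thesis
    unfolding charvec_def map_upt_4 using sel[of "[0..<length v]"] by (simp add: atLeast0LessThan)
qed

section \<open>Hyperedges in the reversed input\<close>

lemma nth_concat_uniform:
  assumes "\<forall>xs\<in>set xss. length xs = k" "r < length xss" "c < k"
  shows "concat xss ! (r * k + c) = xss ! r ! c"
  using assms
proof (induction xss arbitrary: r)
  case (Cons xs xss)
  then show ?case by (cases r) (auto simp: nth_append)
qed simp

lemma length_enc_hyp: "length (enc_hyp n Ss) = Suc (length Ss) * Suc n"
  by (induction Ss) (simp_all add: enc_hyp_def charvec_def)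

lemma nth_enc_hyp:
  assumes "r < length Ss" "i < n"
  shows "enc_hyp n Ss ! (Suc r * Suc n + Suc i) \<longleftrightarrow> i \<in> Ss ! r"
proof -
  have w: "enc_hyp n Ss = (replicate n True @ [False]) @ concat (map (\<lambda>S. True # charvec n S) Ss)"
    by (simp add: enc_hyp_def)
  have "Suc r * Suc n + Suc i = length (replicate n True @ [False]) + (r * Suc n + Suc i)" by simp
  then have "enc_hyp n Ss ! (Suc r * Suc n + Suc i) = concat (map (\<lambda>S. True # charvec n S) Ss) ! (r * Suc n + Suc i)"
    unfolding w by (simp only: nth_append_length_plus)
  also have "\<dots> = map (\<lambda>S. True # charvec n S) Ss ! r ! Suc i"
    by (rule nth_concat_uniform) (use assms in \<open>auto simp: charvec_def\<close>)
  finally show ?thesis using assms by (simp add: charvec_def)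
qed

lemma edge_at_enc_hyp:
  assumes r: "1 \<le> r" "r \<le> length Ss" and Ss: "\<forall>S\<in>set Ss. S \<subseteq> {0..<n}"
  shows "edge_at (rev (enc_hyp n Ss)) n (r * Suc n) = Ss ! (length Ss - r)"
proof -
  let ?w = "enc_hyp n Ss" and ?m = "length Ss"
  have bit: "rev ?w ! d \<longleftrightarrow> i \<in> Ss ! (?m - r)"
    if d: "d + 2 + i = r * Suc n" and i: "i < n" for d i
  proof -
    obtain q where q: "?m = q + r" using r(2) by (metis le_add_diff_inverse2)
    have "r * Suc n \<le> ?m * Suc n" using r by (intro mult_le_mono1)
    then have "d < length ?w" using d by (simp add: length_enc_hyp)
    then have "rev ?w ! d = ?w ! (length ?w - Suc d)" by (rule rev_nth)
    \<comment> \<open>Reversal also reverses the order of the rows: row \<open>r\<close> of the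
      reversed input is hyperedge \<open>q = length Ss - r\<close>. The first \<open>Suc\<close>
      skips the header, the last one the leading \<open>True\<close>.\<close>
    also have "length ?w - Suc d = Suc q * Suc n + Suc i"
      using d q by (simp add: length_enc_hyp algebra_simps)
    also have "?w ! \<dots> \<longleftrightarrow> i \<in> Ss ! q"
      by (rule nth_enc_hyp) (use q r i in auto)
    finally show ?thesis using q by simp
  qed
  have S: "Ss ! (?m - r) \<subseteq> {0..<n}" using Ss r by simp
  show ?thesis
  proof (intro set_eqI iffI)
    fix i
    assume "i \<in> Ss ! (?m - r)"
    then have i: "i < n" using S by auto
    define d where "d = r * Suc n - 2 - i"
    have "1 * Suc n \<le> r * Suc n" using r by (intro mult_le_mono1)
    then have d: "d + 2 + i = r * Suc n" using i by (simp add: d_def)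
    have "r * Suc n \<le> ?m * Suc n" using r by (intro mult_le_mono1)
    then have "d < length ?w" using d by (simp add: length_enc_hyp)
    then show "i \<in> edge_at (rev ?w) n (r * Suc n)"
      using bit[OF d i] d i \<open>i \<in> Ss ! (?m - r)\<close> by (auto simp: edge_at_def)
  qed (auto simp: edge_at_def bit)
qed

lemma edges_enc_hyp:
  assumes Ss: "\<forall>S\<in>set Ss. S \<subseteq> {0..<n}"
  shows "edge_at (rev (enc_hyp n Ss)) n ` edge_positions (rev (enc_hyp n Ss)) n = set Ss"
proof -
  let ?m = "length Ss"
  have "edge_positions (rev (enc_hyp n Ss)) n = (\<lambda>r. r * Suc n) ` {1..?m}"
  proof (intro set_eqI iffI)
    fix y
    assume "y \<in> edge_positions (rev (enc_hyp n Ss)) n"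
    then have y: "y < Suc ?m * Suc n" "Suc n dvd y" "y \<noteq> 0"
      unfolding edge_positions_def length_rev length_enc_hyp by blast+
    from y(2) obtain r where "y = Suc n * r" ..
    then have r: "y = r * Suc n" by (simp only: mult.commute)
    then have "r \<noteq> 0" "r * Suc n < Suc ?m * Suc n" using y by fastforce+
    moreover from this have "r < Suc ?m" by (metis mult_less_cancel2)
    ultimately show "y \<in> (\<lambda>r. r * Suc n) ` {1..?m}" using r by auto
  next
    fix y
    assume "y \<in> (\<lambda>r. r * Suc n) ` {1..?m}"
    then obtain r where r: "y = r * Suc n" "1 \<le> r" "r < Suc ?m" by auto
    then have "r * Suc n < Suc ?m * Suc n" by (metis mult_less_cancel2 zero_less_Suc)
    then show "y \<in> edge_positions (rev (enc_hyp n Ss)) n"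
      using r by (simp add: edge_positions_def length_enc_hyp del: mult_Suc mult_Suc_right)
  qed
  then have "edge_at (rev (enc_hyp n Ss)) n ` edge_positions (rev (enc_hyp n Ss)) n
      = (\<lambda>r. Ss ! (?m - r)) ` {1..?m}"
    using edge_at_enc_hyp[OF _ _ Ss] by (force simp: image_image)
  also have "\<dots> = set Ss"
  proof (intro set_eqI iffI)
    fix S
    assume "S \<in> set Ss"
    then obtain j where "j < ?m" "S = Ss ! j" by (metis in_set_conv_nth)
    then show "S \<in> (\<lambda>r. Ss ! (?m - r)) ` {1..?m}" by (intro image_eqI[of _ _ "?m - j"]) auto
  qed auto
  finally show ?thesis .
qed

section \<open>Composition with an enumerator and output filtering\<close>

text \<open>The output filter reads words in pairs of bits \<open>a b\<close> and emits \<open>a\<close> iff \<open>b = 1\<close>.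
  Its state is 0 before \<open>a\<close>, and \<open>1 + a\<close> before \<open>b\<close>.\<close>

definition filter_state :: "nat \<Rightarrow> osym option \<Rightarrow> nat" where
  "filter_state r e = (case e of None \<Rightarrow> r | Some OSep \<Rightarrow> 0
     | Some OZero \<Rightarrow> (if r = 0 then 1 else 0) | Some OOne \<Rightarrow> (if r = 0 then 2 else 0))"

definition filter_emit :: "nat \<Rightarrow> osym option \<Rightarrow> osym option" where
  "filter_emit r e = (case e of Some OSep \<Rightarrow> Some OSep
     | Some OOne \<Rightarrow> (if r = 0 then None else Some (osym_of_bool (r = 2))) | _ \<Rightarrow> None)"

definition opt_list :: "'a option \<Rightarrow> 'a list" where
  "opt_list e = (case e of None \<Rightarrow> [] | Some s \<Rightarrow> [s])"

primrec filter_word :: "nat \<Rightarrow> osym list \<Rightarrow> osym list" where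
  "filter_word r [] = []"
| "filter_word r (a # as) = opt_list (filter_emit r (Some a)) @ filter_word (filter_state r (Some a)) as"

lemma filter_state_less: "r < 3 \<Longrightarrow> filter_state r e < 3"
  by (auto simp: filter_state_def split: option.splits osym.splits)

lemma filter_word_append:
  "filter_word r (as @ bs) = filter_word r as @ filter_word (fold (\<lambda>a r. filter_state r (Some a)) as r) bs"
  by (induction as arbitrary: r) auto

lemma filter_word_solution:
  assumes "even (length x)"
  shows "filter_word 0 (map osym_of_bool x @ [OSep] @ as) =
    map osym_of_bool (selected x) @ [OSep] @ filter_word 0 as"
  using assms
  by (induction x rule: selected.induct)
    (auto simp: filter_emit_def filter_state_def opt_list_def osym_of_bool_def)

lemma filter_word_solutions:
  assumes "\<forall>x\<in>set xs. even (length x)"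
  shows "filter_word 0 (concat (map (\<lambda>x. map osym_of_bool x @ [OSep]) xs)) =
    concat (map (\<lambda>x. map osym_of_bool x @ [OSep]) (map selected xs))"
  using assms
proof (induction xs)
  case (Cons x xs)
  then show ?case
    using filter_word_solution[of x "concat (map (\<lambda>x. map osym_of_bool x @ [OSep]) xs)"] by simp
qed simp

text \<open>The factor 3 is the number of filter states. State 0 uses row 0 of the table because
  \<open>0 - 1 = 0\<close>; state 1 would use it as well, but a machine in state 1 has
  halted.\<close>

definition compose_tm :: "table \<Rightarrow> nat \<Rightarrow> tm \<Rightarrow> tm" where
  "compose_tm \<delta> m M = \<lparr> tm_states = m + 1 + 3 * tm_states M,
     tm_delta = (\<lambda>s a.
       if s \<le> m then
         (case \<delta> (s - 1) a of (q, b, d) \<Rightarrow> (if q = 0 then 0 else q + 1, b, d, None))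
       else
         (let q = (s - (m + 1)) div 3; r = (s - (m + 1)) mod 3 in
          case tm_delta M q a of (q', b, d, e) \<Rightarrow>
            (if q' = 1 then 1 else m + 1 + 3 * q' + filter_state r e, b, d, filter_emit r e))) \<rparr>"

text \<open>State \<open>q\<close> of the preprocessing table becomes \<open>q + 1\<close>, except that the start state
  keeps the number 0; so the halting state 1 stays free and the exit state \<open>m\<close> becomes
  \<open>m + 1\<close>, which also encodes the pair of start states of the second phase.\<close>

definition pre_state :: "nat \<Rightarrow> nat" where
  "pre_state q = (if q = 0 then 0 else q + 1)"

definition main_state :: "nat \<Rightarrow> nat \<Rightarrow> nat \<Rightarrow> nat" where
  "main_state m q r = (if q = 1 then 1 else m + 1 + 3 * q + r)"

lemma compose_tm_pre:
  assumes "q < m"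
  shows "tm_delta (compose_tm \<delta> m M) (pre_state q) a =
    (case \<delta> q a of (q', b, d) \<Rightarrow> (pre_state q', b, d, None))"
  using assms by (auto simp: compose_tm_def pre_state_def split: prod.splits)

lemma compose_tm_main:
  assumes "q \<noteq> 1" "r < 3"
  shows "tm_delta (compose_tm \<delta> m M) (main_state m q r) a =
    (case tm_delta M q a of (q', b, d, e) \<Rightarrow> (main_state m q' (filter_state r e), b, d, filter_emit r e))"
proof -
  have "(3 * q + r) div 3 = q" "(3 * q + r) mod 3 = r" using assms by simp_all
  then show ?thesis using assms by (auto simp: compose_tm_def main_state_def split: prod.splits)
qed

lemma compose_tm_wf:
  assumes "tm_wf M" "0 < m" "\<And>q a. q < m \<Longrightarrow> fst (\<delta> q a) \<le> m"
  shows "tm_wf (compose_tm \<delta> m M)"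
  unfolding tm_wf_def
proof (intro conjI allI impI)
  have M: "2 \<le> tm_states M" "\<And>q a. q < tm_states M \<Longrightarrow> fst (tm_delta M q a) < tm_states M"
    using assms(1) by (auto simp: tm_wf_def)
  then show "2 \<le> tm_states (compose_tm \<delta> m M)" by (simp add: compose_tm_def)
  fix s a
  assume s: "s < tm_states (compose_tm \<delta> m M)"
  show "fst (tm_delta (compose_tm \<delta> m M) s a) < tm_states (compose_tm \<delta> m M)"
  proof (cases "s \<le> m")
    case True
    then have "fst (\<delta> (s - 1) a) \<le> m" using assms(2) by (intro assms(3)) auto
    then show ?thesis using True M by (auto simp: compose_tm_def split: prod.splits)
  next
    case False
    let ?q = "(s - (m + 1)) div 3" and ?r = "(s - (m + 1)) mod 3"
    obtain q' b d e where q': "tm_delta M ?q a = (q', b, d, e)" by (metis prod_cases4)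
    have "?q < tm_states M" using False s by (simp add: compose_tm_def less_mult_imp_div_less mult.commute)
    then have "q' < tm_states M" using M(2)[of ?q a] q' by simp
    moreover have "filter_state ?r e < 3" by (rule filter_state_less) simp
    ultimately show ?thesis using False q' M by (auto simp: compose_tm_def Let_def)
  qed
qed

lemma conf_Suc: "conf M w (Suc t) = step M (conf M w t)"
  by (simp add: conf_def)

context
  fixes \<delta> :: table and m :: nat and M :: tm and w w' :: "bool list" and t0 :: nat
  assumes m: "0 < m"
    and pre: "freach \<delta> m (0, input_tape w, 0) t0 (m, input_tape w', 0)"
begin

abbreviation "M' \<equiv> compose_tm \<delta> m M"

lemma freach_run:
  "freach \<delta> m c t c' \<Longrightarrow> t' < t \<Longrightarrow>
     fst (((step M') ^^ t') (apfst pre_state c)) \<noteq> 1 \<and> emit M' (((step M') ^^ t') (apfst pre_state c)) = None"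
  "freach \<delta> m c t c' \<Longrightarrow> ((step M') ^^ t) (apfst pre_state c) = apfst pre_state c'"
proof (induction arbitrary: t' rule: freach.induct)
  case (step c t c')
  obtain q T p where c: "c = (q, T, p)" by (cases c)
  have q: "q < m" using step.hyps(1) c by simp
  have ne: "pre_state q \<noteq> 1" by (simp add: pre_state_def)
  have one: "step M' (apfst pre_state c) = apfst pre_state (fstep \<delta> c)"
    using ne by (auto simp: c step_def fstep_def compose_tm_pre[OF q] split: prod.splits)
  then have iter: "((step M') ^^ Suc i) (apfst pre_state c) = ((step M') ^^ i) (apfst pre_state (fstep \<delta> c))" for i
    by (simp only: funpow_Suc_right comp_apply)
  {
    case 1
    have "emit M' (apfst pre_state c) = None"
      by (auto simp: c emit_def compose_tm_pre[OF q] split: prod.splits)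
    moreover have "fst (apfst pre_state c) \<noteq> 1" using ne by (simp add: c)
    ultimately show ?case
      using 1 step.IH(1) by (cases t') (auto simp only: iter funpow_0 Suc_less_eq)
  next
    case 2
    then show ?case using step.IH(2) by (simp only: iter)
  }
qed simp_all

lemma conf_pre:
  "t < t0 \<Longrightarrow> \<not> halted (conf M' w t)"
  "t < t0 \<Longrightarrow> emit M' (conf M' w t) = None"
  "conf M' w t0 = (main_state m 0 0, input_tape w', 0)"
  using freach_run[OF pre] m
  by (simp_all add: conf_def halted_def init_conf_input_tape pre_state_def main_state_def)

primrec fstate :: "nat \<Rightarrow> nat" where
  "fstate 0 = 0"
| "fstate (Suc t) = filter_state (fstate t) (emit M (conf M w' t))"

lemma fstate_less: "fstate t < 3"
  by (induction t) (auto intro: filter_state_less)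

text \<open>The two machines run in lockstep. After halting, \<open>main_state\<close> ignores the
  filter state, so the equation persists for all later times.\<close>

lemma conf_main:
  "conf M' w (t0 + t) = (main_state m (fst (conf M w' t)) (fstate t), snd (conf M w' t))"
proof (induction t)
  case 0
  show ?case using conf_pre(3) by (simp add: conf_def init_conf_input_tape)
next
  case (Suc t)
  obtain q T p where c: "conf M w' t = (q, T, p)" by (cases "conf M w' t")
  show ?case
  proof (cases "q = 1")
    case True
    then show ?thesis using Suc c by (simp add: conf_Suc step_def main_state_def)
  next
    case False
    then have ne: "main_state m q (fstate t) \<noteq> 1" using m by (simp add: main_state_def)
    show ?thesis
      using Suc c ne False
      by (auto simp: conf_Suc step_def emit_def compose_tm_main[OF False fstate_less] split: prod.splits)
  qed
qed

lemma halted_main: "halted (conf M' w (t0 + t)) \<longleftrightarrow> halted (conf M w' t)"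
  using m by (simp add: conf_main halted_def main_state_def)

lemma emit_main: "emit M' (conf M' w (t0 + t)) = filter_emit (fstate t) (emit M (conf M w' t))"
proof -
  obtain q T p where c: "conf M w' t = (q, T, p)" by (cases "conf M w' t")
  show ?thesis
  proof (cases "q = 1")
    case True
    then show ?thesis by (simp add: conf_main c emit_def main_state_def filter_emit_def)
  next
    case False
    then have ne: "main_state m q (fstate t) \<noteq> 1" using m by (simp add: main_state_def)
    show ?thesis
      using ne False by (auto simp: conf_main c emit_def compose_tm_main[OF False fstate_less] split: prod.splits)
  qed
qed

lemma tm_output_opt_list: "tm_output N u t = concat (map (\<lambda>i. opt_list (emit N (conf N u i))) [0..<t])"
  by (simp add: tm_output_def opt_list_def)

lemma tm_output_main: "tm_output M' w (t0 + t) = filter_word 0 (tm_output M w' t)"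
proof -
  \<comment> \<open>The second conjunct is what the induction needs: the filter state reached by
    reading the output so far decides how the next symbol is treated.\<close>
  have "tm_output M' w (t0 + t) = filter_word 0 (tm_output M w' t) \<and>
      fold (\<lambda>a r. filter_state r (Some a)) (tm_output M w' t) 0 = fstate t"
  proof (induction t)
    case 0
    show ?case by (simp add: tm_output_def conf_pre(2))
  next
    case (Suc t)
    have "tm_output M' w (t0 + Suc t) = tm_output M' w (t0 + t) @ opt_list (emit M' (conf M' w (t0 + t)))"
      "tm_output M w' (Suc t) = tm_output M w' t @ opt_list (emit M (conf M w' t))"
      by (simp_all add: tm_output_opt_list)
    with Suc show ?case
      by (cases "emit M (conf M w' t)")
        (simp_all add: emit_main filter_word_append opt_list_def filter_state_def filter_emit_def)
  qed
  then show ?thesis ..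
qed

text \<open>Separators occur at the old times shifted by \<open>t0\<close>. Only a wait that begins
  in the first phase gets longer, by at most \<open>t0\<close>. Injectivity of
  \<open>selected\<close> keeps the outputs distinct.\<close>

lemma enum_compose:
  assumes enum: "enum_poly_delay M c k w' P"
    and P: "\<forall>x\<in>P. even (length x)" "inj_on selected P"
    and bound: "t0 + c * (length w' + 1) ^ k \<le> c' * (length w + 1) ^ k'"
  shows "enum_poly_delay M' c' k' w (selected ` P)"
proof -
  from enum obtain T xs where T: "halted (conf M w' T)" "\<forall>t<T. \<not> halted (conf M w' t)"
    and xs: "distinct xs" "set xs = P"
      "tm_output M w' T = concat (map (\<lambda>x. map osym_of_bool x @ [OSep]) xs)"
    and delay: "\<forall>t<T. \<exists>s. t < s \<and> s \<le> t + c * (length w' + 1) ^ k \<and>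
             (s = T \<or> emit M (conf M w' (s - 1)) = Some OSep)"
    unfolding enum_poly_delay_def by blast
  have "init_conf w' = (0, input_tape w', 0)" by (rule init_conf_input_tape)
  then have "\<not> halted (conf M w' 0)" by (simp add: conf_def halted_def)
  \<comment> \<open>The start state differs from the halting state. Hence the delay bound of the
    enumerator applies at its time 0, which bounds the wait from any moment of the first
    phase.\<close>
  then have T0: "0 < T" using T(1) by (cases T) auto
  have delay': "\<exists>s'. t0 + t < s' \<and> s' \<le> t0 + t + c * (length w' + 1) ^ k \<and>
      (s' = t0 + T \<or> emit M' (conf M' w (s' - 1)) = Some OSep)" if "t < T" for t
  proof -
    obtain s where s: "t < s" "s \<le> t + c * (length w' + 1) ^ k"
        "s = T \<or> emit M (conf M w' (s - 1)) = Some OSep"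
      using delay \<open>t < T\<close> by blast
    then have "t0 + s - 1 = t0 + (s - 1)" by simp
    then have "s = T \<or> emit M' (conf M' w (t0 + s - 1)) = Some OSep"
      using s(3) by (auto simp: emit_main filter_emit_def)
    then show ?thesis using s by (intro exI[of _ "t0 + s"]) auto
  qed
  show ?thesis
    unfolding enum_poly_delay_def
  proof (rule exI[of _ "t0 + T"], intro conjI allI impI)
    show "halted (conf M' w (t0 + T))" by (simp add: halted_main T)
    show "\<not> halted (conf M' w t)" if "t < t0 + T" for t
    proof (cases "t < t0")
      case False
      then have "\<not> halted (conf M' w (t0 + (t - t0)))"
        unfolding halted_main using that T(2) by auto
      then show ?thesis using False by simp
    qed (rule conf_pre)
    show "\<exists>ys. distinct ys \<and> set ys = selected ` P \<and>
        tm_output M' w (t0 + T) = concat (map (\<lambda>x. map osym_of_bool x @ [OSep]) ys)"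
    proof (rule exI[of _ "map selected xs"], intro conjI)
      show "distinct (map selected xs)" using xs P by (simp add: distinct_map)
      show "set (map selected xs) = selected ` P" using xs by simp
      show "tm_output M' w (t0 + T) = concat (map (\<lambda>x. map osym_of_bool x @ [OSep]) (map selected xs))"
        unfolding tm_output_main xs(3) by (rule filter_word_solutions) (use xs P in auto)
    qed
    show "\<exists>s>t. s \<le> t + c' * (length w + 1) ^ k' \<and> (s = t0 + T \<or> emit M' (conf M' w (s - 1)) = Some OSep)"
      if "t < t0 + T" for t
    proof (cases "t < t0")
      case True
      obtain s' where "t0 + 0 < s'" "s' \<le> t0 + 0 + c * (length w' + 1) ^ k"
          "s' = t0 + T \<or> emit M' (conf M' w (s' - 1)) = Some OSep"
        using delay'[OF T0] by blast
      then show ?thesis using True bound by (intro exI[of _ s']) auto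
    next
      case False
      then have "t - t0 < T" "t0 + (t - t0) = t" using that by auto
      then obtain s' where "t < s'" "s' \<le> t + c * (length w' + 1) ^ k"
          "s' = t0 + T \<or> emit M' (conf M' w (s' - 1)) = Some OSep"
        using delay'[of "t - t0"] by auto
      then show ?thesis using bound by (intro exI[of _ s']) auto
    qed
  qed
qed

end

lemma charvec_inj: "charvec n H = charvec n H' \<Longrightarrow> H \<subseteq> {0..<n} \<Longrightarrow> H' \<subseteq> {0..<n} \<Longrightarrow> H = H'"
  by (auto simp: charvec_def)

theorem mainTheorem11:
  shows "(\<exists>M c k. enumerates_min_cds_split_poly_delay M c k) \<longrightarrow>
         (\<exists>M c k. enumerates_min_hs_poly_delay M c k)"
proof
  assume "\<exists>M c k. enumerates_min_cds_split_poly_delay M c k"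
  then obtain M c k where M: "tm_wf M"
    and enum: "\<And>n E. is_graph n E \<Longrightarrow> split_graph n E \<Longrightarrow>
      enum_poly_delay M c k (enc_graph n E) {charvec n S | S. is_min_cds n E S}"
    unfolding enumerates_min_cds_split_poly_delay_def by blast
  let ?f = "\<lambda>w. snd (exec (rev w) emit_graph (\<lambda>_. 0, []))"
  have "\<exists>m B. poly_bounded B \<and> (\<forall>w. runs m (input_tape w, 0) (B (length w)) (input_tape (?f w), 0)) \<and>
      (\<forall>w. length (?f w) \<le> B (length w))"
    by (rule com_computable[OF wfc_emit_graph]) simp
  then obtain mc B where B: "poly_bounded B"
    and run: "\<And>w. runs mc (input_tape w, 0) (B (length w)) (input_tape (?f w), 0)"
    and len: "\<And>w. length (?f w) \<le> B (length w)"
    by blast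
  obtain \<delta> m where impl: "implements \<delta> m mc"
    using micro_implementable by blast
  \<comment> \<open>The first summand pays for the first phase, the second for a delay of the
    enumerator on a graph encoding of length at most \<open>B L\<close>.\<close>
  have "poly_bounded (\<lambda>L. B L + c * (B L + 1) ^ k)"
    by (intro poly_bounded_intros B)
  then obtain c' k' where bound: "\<And>L. B L + c * (B L + 1) ^ k \<le> c' * (L + 1) ^ k'"
    unfolding poly_bounded_def by blast
  have "enum_poly_delay (compose_tm \<delta> m M) c' k' (enc_hyp n Ss)
      {charvec n H | H. min_hitting_set {0..<n} (set Ss) H}"
    if Ss: "\<forall>S\<in>set Ss. S \<subseteq> {0..<n}" for n Ss
  proof -
    let ?w = "enc_hyp n Ss" and ?v = "rev (enc_hyp n Ss)"
    let ?P = "{charvec (4 * length ?v) S | S. is_min_cds (4 * length ?v) (adj ?v n) S}"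
    have "?v = rev (concat (map (\<lambda>S. True # charvec n S) Ss)) @ False # replicate n True"
      by (simp add: enc_hyp_def)
    then have f: "?f ?w = enc_graph (4 * length ?v) (adj ?v n)"
      by (rule emit_graph_correct)
    obtain t0 where t0: "t0 \<le> B (length ?w)" "mrun mc (input_tape ?w, 0) t0 (input_tape (?f ?w), 0)"
      using run[of ?w] unfolding runs_def by blast
    have pre: "freach \<delta> m (0, input_tape ?w, 0) t0 (m, input_tape (?f ?w), 0)" and m: "0 < m"
      using impl t0(2) by (auto simp: implements_def)
    have n: "n < length ?v" by (simp add: length_enc_hyp)
    note mins = min_cds_adj[OF n, unfolded edges_enc_hyp[OF Ss]]
    have sel: "selected (charvec (4 * length ?v) (embed ?v n H)) = charvec n H"
      if "min_hitting_set {0..<n} (set Ss) H" for H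
      by (rule selected_charvec_embed) (use n that in \<open>auto simp: min_hitting_set_def hitting_set_def\<close>)
    have P: "?P = (\<lambda>H. charvec (4 * length ?v) (embed ?v n H)) ` {H. min_hitting_set {0..<n} (set Ss) H}"
      unfolding mins by blast
    have image: "selected ` ?P = {charvec n H | H. min_hitting_set {0..<n} (set Ss) H}"
      unfolding P image_image using sel by force
    \<comment> \<open>By \<open>sel\<close>, decoding the vector of \<open>embed ?v n H\<close>
      gives \<open>charvec n H\<close>, which determines \<open>H\<close> as a subset of
      \<open>{0..<n}\<close>.\<close>
    have inj: "inj_on selected ?P"
      unfolding P
    proof (intro inj_on_imageI inj_onI)
      fix H H'
      assume H: "H \<in> {H. min_hitting_set {0..<n} (set Ss) H}" "H' \<in> {H. min_hitting_set {0..<n} (set Ss) H}"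
        and "(selected \<circ> (\<lambda>H. charvec (4 * length ?v) (embed ?v n H))) H =
          (selected \<circ> (\<lambda>H. charvec (4 * length ?v) (embed ?v n H))) H'"
      then have "charvec n H = charvec n H'" by (simp only: comp_apply mem_Collect_eq sel)
      moreover have "H \<subseteq> {0..<n}" "H' \<subseteq> {0..<n}"
        using H by (auto simp: min_hitting_set_def hitting_set_def)
      ultimately show "H = H'" by (rule charvec_inj)
    qed
    have "enum_poly_delay (compose_tm \<delta> m M) c' k' ?w (selected ` ?P)"
    proof (rule enum_compose[OF m pre _ _ inj])
      show "enum_poly_delay M c k (?f ?w) ?P"
        unfolding f by (rule enum[OF adj_graph adj_split])
      show "\<forall>x\<in>?P. even (length x)" by (auto simp: charvec_def)
      have "c * (length (?f ?w) + 1) ^ k \<le> c * (B (length ?w) + 1) ^ k"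
        using len[of ?w] by (intro mult_le_mono2 power_mono) auto
      then show "t0 + c * (length (?f ?w) + 1) ^ k \<le> c' * (length ?w + 1) ^ k'"
        using t0(1) bound[of "length ?w"] by linarith
    qed
    then show ?thesis unfolding image .
  qed
  moreover have "tm_wf (compose_tm \<delta> m M)"
    by (rule compose_tm_wf) (use M impl in \<open>auto simp: implements_def\<close>)
  ultimately show "\<exists>M c k. enumerates_min_hs_poly_delay M c k"
    unfolding enumerates_min_hs_poly_delay_def by blast
qed

end
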